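(* Let $d\geq 2$, let $W\subset\mathbb{R}^d$ be a non-empty compact convex set with $\lambda_d(W)>0$, and for $s\geq 1$ let $\eta_s$ be a Poisson process on $\mathbb{R}^d$ with intensity measure $s\lambda_d|_W$. Let $k\in\mathbb{N}$, let $V_j^k$ be the number of vertices of degree $j$ in the $k$-nearest neighbour graph generated by $\eta_s$, and let $k_{\mathrm{max}}$ be the maximal possible vertex degree that occurs with positive probability. Let $n\leq k_{\mathrm{max}}-k+1$ and let $j_1,\dots,j_n\in\{k,k+1,\dots,k_{\mathrm{max}}\}$ be distinct. Then for $s\to\infty$ the asymptotic covariance matrix of $\frac{1}{\sqrt{s}}(V_{j_1}^k,\dots, V_{j_n}^k)$ is positive definite, i.e. for any $\alpha=(\alpha_1,\dots,\alpha_n)\in\mathbb{R}^n\setminus\{0\}$ there exists a constant $c>0$ such that for all $s$ sufficiently large $$\mathrm{Var}\left[\sum_{i=1}^{n}\alpha_iV_{j_i}^{k}\right]\geq cs.$$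
   Context: $\lambda_d$ is $d$-dimensional Lebesgue measure and $\lambda_d|_W$ its restriction to $W$. The point process $\eta_s$ is identified with the random set of its points. For $y\in\eta_s$, $N(y,\eta_s)$ denotes the set of the $k$ nearest neighbours of $y$ in $\eta_s\setminus\{y\}$ (Euclidean distance; almost surely there are no ties), i.e. the set of all $z\in\eta_s\setminus\{y\}$ such that the closed ball centred at $y$ with radius $\lVert y-z\rVert$ contains at most $k$ points of $\eta_s\setminus\{y\}$. The $k$-nearest neighbour graph generated by $\eta_s$ is the undirected graph with vertex set $\eta_s$ in which $y\neq z$ are joined iff $z\in N(y,\eta_s)$ or $y\in N(z,\eta_s)$. With $\mathrm{deg}(y,\eta_s)$ the degree of $y$ in this graph, $$V_j^{k}=\sum_{y\in\eta_s}\mathbf{1}\{\mathrm{deg}(y,\eta_s)=j\}.$$ It is known that the vertex degrees of $k$-nearest neighbour graphs in $\mathbb{R}^d$ are bounded (by a constant depending only on $k$ and $d$); $k_{\mathrm{max}}$ is the largest integer $j$ such that a vertex of degree $j$ occurs with positive probability in the $k$-nearest neighbour graph. "The asymptotic covariance matrix is positive definite" is to be understood as the variance lower bound stated after "i.e.". *)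

theory Defs
  imports "HOL-Probability.Probability"
begin

(* A point process without multiple points is represented by the random set of its points.
   Counts are extended nonnegative reals, since a locally finite set may have infinitely many
   points in an unbounded set.  Simple processes suffice for diffuse intensity measures
   (a locally finite measure with atoms admits no process in the sense below).  For locally finite intensity,
   the almost sure infinitude of the counts on sets of infinite measure follows from the
   clauses given. *)

definition point_count :: "'a set \<Rightarrow> 'a set \<Rightarrow> ennreal" where
  "point_count X B = emeasure (count_space UNIV) (X \<inter> B)"

definition poisson_process ::
  "'w measure \<Rightarrow> 'a::euclidean_space measure \<Rightarrow> ('w \<Rightarrow> 'a set) \<Rightarrow> bool" where
  "poisson_process P \<Lambda> \<eta> \<longleftrightarrow>
     prob_space P \<and>
     (\<forall>\<omega>\<in>space P. \<forall>B. bounded B \<longrightarrow> finite (\<eta> \<omega> \<inter> B)) \<and>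
     (\<forall>B\<in>sets borel. (\<lambda>\<omega>. point_count (\<eta> \<omega>) B) \<in> borel_measurable P) \<and>
     (\<forall>B\<in>sets borel. emeasure \<Lambda> B < \<infinity> \<longrightarrow>
        (\<forall>m::nat. measure P {\<omega> \<in> space P. point_count (\<eta> \<omega>) B = of_nat m} =
           exp (- measure \<Lambda> B) * measure \<Lambda> B ^ m / fact m)) \<and>
     (\<forall>(B :: nat \<Rightarrow> 'a set) I. finite I \<and> disjoint_family_on B I \<and> (\<forall>i\<in>I. B i \<in> sets borel) \<longrightarrow>
        prob_space.indep_vars P (\<lambda>_. borel) (\<lambda>i \<omega>. point_count (\<eta> \<omega>) (B i)) I)"

definition restricted_lebesgue :: "real \<Rightarrow> 'a::euclidean_space set \<Rightarrow> 'a measure" where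
  "restricted_lebesgue s W = scale_measure (ennreal s) (density lborel (indicator W))"

(* Only meaningful for locally finite X: the card of an infinite set is 0. *)

definition nearest_neighbours :: "nat \<Rightarrow> 'a::metric_space set \<Rightarrow> 'a \<Rightarrow> 'a set" where
  "nearest_neighbours k X y =
     {z \<in> X - {y}. card (cball y (dist y z) \<inter> (X - {y})) \<le> k}"

definition knn_adjacent :: "nat \<Rightarrow> 'a::metric_space set \<Rightarrow> 'a \<Rightarrow> 'a \<Rightarrow> bool" where
  "knn_adjacent k X y z \<longleftrightarrow> y \<in> X \<and> z \<in> X \<and> y \<noteq> z \<and>
     (z \<in> nearest_neighbours k X y \<or> y \<in> nearest_neighbours k X z)"

definition knn_degree :: "nat \<Rightarrow> 'a::metric_space set \<Rightarrow> 'a \<Rightarrow> nat" where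
  "knn_degree k X y = card {z. knn_adjacent k X y z}"

definition num_degree :: "nat \<Rightarrow> nat \<Rightarrow> 'a::metric_space set \<Rightarrow> nat" where
  "num_degree k j X = card {y \<in> X. knn_degree k X y = j}"

(* The set of degrees occurring with positive probability is finite and nonempty, and for Poisson
   processes with intensity measures s * (Lebesgue measure on W) its maximum for fixed s is the
   same for all s; the existential quantifier merely removes s from the notation. *)

definition k_max :: "(real \<Rightarrow> 'w measure) \<Rightarrow> (real \<Rightarrow> 'w \<Rightarrow> 'a::metric_space set) \<Rightarrow> nat \<Rightarrow> nat" where
  "k_max P \<eta> k =
     Max {j. \<exists>s\<ge>1. measure (P s) {\<omega> \<in> space (P s). \<exists>y\<in>\<eta> s \<omega>. knn_degree k (\<eta> s \<omega>) y = j} > 0}"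

end

(* Write h = s^(-1/d).  W contains at least a constant times s disjoint balls of radius 12h.  In such
   a ball B(x, 12h) let S be the event that the shell outside B(x, 2h) carries clusters of k + 1 points
   in all directions and nothing else: then no edge of the graph joins B(x, 2h) to its complement as
   soon as B(x, 2h) contains at least k + 1 points.  Let A be the event that B(x, 2h) carries a pattern
   whose graph contributes a fixed f ~= 0 to the linear combination F of the V_j, and B the event
   that B(x, 2h) is empty.  The functions g = 1_S (P(B) 1_A - P(A) 1_B) belonging to different balls are
   centred and uncorrelated, and E[F g] = f P(A) P(B) P(S) because the contribution of the points
   outside B(x, 2h) is independent of A and B.  Expanding the square in
   0 <= E(F - E F - kappa (sum of the g))^2 with kappa = f P(A) P(B) P(S) gives
   Var F >= kappa^2 * (number of balls).

   For the pattern, let D be the least degree with nonzero coefficient.  A cluster of k + 1 points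
   settles D = k.  For D = q k + t with 1 <= t <= k < D, put q clusters of k points near unit vectors
   around a central point and k + 1 points near another unit vector, t of them slightly closer to the
   centre than distance 1 and the others slightly farther: the centre has degree D and all other degrees
   are k or k + 1.  The unit vectors must have mutual distances greater than 1; they exist because
   a vertex of degree k_max yields at least k_max / k such directions. *)

theory Submission
  imports Defs
begin

text \<open>The degree of a vertex is not determined by a neighbourhood of fixed size, and inserting
  points destroys edges as well as creating them. The shell makes the effect of a local change
  exact: with the pattern inside, the graph on the outer points is the graph that they generate
  alone, and with an empty ball this is trivially so. The outer contribution is therefore the same
  function of the outer points in both cases and cancels in E[F g].

  The cluster sizes are dictated by what a point lacks. In a cluster of k points each finds only k -
  1 others nearby and takes the centre as its last neighbour, since the other clusters are farther
  away than 1. A cluster of k + 1 points supplies its own neighbours and is joined to the centre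
  only at the t points that the centre itself selects. The by-products have degree k or k + 1, and D
  is taken least so that they cannot cancel the contribution of the centre.

  All distance comparisons are strict, so a pattern survives small displacements of its points and
  has positive probability; at the scale h this probability is the same for all s.\<close>

section \<open>Nearest neighbours and separation of the graph\<close>

text \<open>Ties inside \<open>A\<close> are harmless: a closed ball around \<open>y\<close> through
  a point of \<open>A\<close> contains only points of \<open>A\<close>, while one through any other
  point contains that point and all of \<open>A\<close>.\<close>

lemma nearest_neighbours_eq:
  assumes "finite X" "A \<subseteq> X - {y}" "card A = k"
    and closer: "\<And>a x. a \<in> A \<Longrightarrow> x \<in> X - {y} - A \<Longrightarrow> dist y a < dist y x"
  shows "nearest_neighbours k X y = A"
proof (intro set_eqI iffI)
  fix z assume z: "z \<in> A"
  have "cball y (dist y z) \<inter> (X - {y}) \<subseteq> A"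
    using closer[OF z] by fastforce
  moreover have "finite A" using assms(1,2) finite_subset by blast
  ultimately have "card (cball y (dist y z) \<inter> (X - {y})) \<le> k"
    using card_mono assms(3) by metis
  then show "z \<in> nearest_neighbours k X y"
    using z assms(2) by (auto simp: nearest_neighbours_def)
next
  fix z assume z: "z \<in> nearest_neighbours k X y"
  show "z \<in> A"
  proof (rule ccontr)
    assume nz: "z \<notin> A"
    have zX: "z \<in> X - {y} - A" using z nz by (auto simp: nearest_neighbours_def)
    have "insert z A \<subseteq> cball y (dist y z) \<inter> (X - {y})"
      using closer[OF _ zX] assms(2) zX by (auto simp: less_imp_le)
    then have "card (insert z A) \<le> card (cball y (dist y z) \<inter> (X - {y}))"
      using assms(1) by (intro card_mono) auto
    also have "\<dots> \<le> k" using z by (auto simp: nearest_neighbours_def)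
    finally show False
      using nz assms finite_subset[of A "X - {y}"] by auto
  qed
qed

text \<open>A closed ball around \<open>y\<close> that reaches \<open>Q\<close> contains
  \<open>k\<close> points of \<open>I\<close> strictly closer than \<open>Q\<close> and also the
  point through which it is drawn, so its count exceeds \<open>k\<close>, with or without
  \<open>Q\<close>. A ball that does not reach \<open>Q\<close> has the same count in both
  configurations.\<close>

lemma nearest_neighbours_separated:
  assumes "finite I" "finite Q" "I \<inter> Q = {}" "y \<in> I"
    and sep: "\<And>z. z \<in> Q \<Longrightarrow> k \<le> card {x \<in> I - {y}. dist y x < dist y z}"
  shows "nearest_neighbours k (I \<union> Q) y = nearest_neighbours k I y"
proof -
  have far: "Suc k \<le> card (cball y (dist y z') \<inter> ((I \<union> Q) - {y})) \<and>
             (z' \<in> I \<longrightarrow> Suc k \<le> card (cball y (dist y z') \<inter> (I - {y})))"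
    if z: "z \<in> Q" and z': "z' \<in> I \<union> Q - {y}" and le: "dist y z \<le> dist y z'" for z z'
  proof -
    let ?C = "{x \<in> I - {y}. dist y x < dist y z}"
    have c: "Suc k \<le> card (insert z' ?C)"
      using sep[OF z] le assms(1) by (subst card_insert_disjoint) auto
    have "insert z' ?C \<subseteq> cball y (dist y z') \<inter> ((I \<union> Q) - {y})"
      using z' le by auto
    moreover have "z' \<in> I \<longrightarrow> insert z' ?C \<subseteq> cball y (dist y z') \<inter> (I - {y})"
      using z' le by auto
    ultimately show ?thesis
      using c card_mono assms(1,2) by (meson finite_Diff finite_Int finite_UnI order_trans)
  qed
  have "z \<in> nearest_neighbours k (I \<union> Q) y \<longleftrightarrow> z \<in> nearest_neighbours k I y" for z
  proof (cases "z \<in> I - {y}")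
    case True
    show ?thesis
    proof (cases "\<exists>w\<in>Q. dist y w \<le> dist y z")
      case True
      then obtain w where w: "w \<in> Q" "dist y w \<le> dist y z" by blast
      show ?thesis using far[of w z] w \<open>z \<in> I - {y}\<close> by (auto simp: nearest_neighbours_def)
    next
      case False
      then have "cball y (dist y z) \<inter> ((I \<union> Q) - {y}) = cball y (dist y z) \<inter> (I - {y})"
        by auto
      then show ?thesis using True by (auto simp: nearest_neighbours_def)
    qed
  next
    case False
    show ?thesis
    proof (cases "z \<in> Q - {y}")
      case True
      then show ?thesis using far[of z z] False by (auto simp: nearest_neighbours_def)
    next
      case nO: False
      then show ?thesis using False by (auto simp: nearest_neighbours_def)
    qed
  qed
  then show ?thesis by blast
qed

text \<open>One endpoint selecting the other suffices for an edge, so the separation has to hold as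
  seen from both sides; then no edge joins \<open>I\<close> to \<open>Q\<close>.\<close>

lemma num_degree_separated:
  assumes fin: "finite I" "finite Q" "I \<inter> Q = {}"
    and sepI: "\<And>y z. y \<in> I \<Longrightarrow> z \<in> Q \<Longrightarrow> k \<le> card {x \<in> I - {y}. dist y x < dist y z}"
    and sepO: "\<And>y z. y \<in> Q \<Longrightarrow> z \<in> I \<Longrightarrow> k \<le> card {x \<in> Q - {y}. dist y x < dist y z}"
  shows "num_degree k j (I \<union> Q) = num_degree k j I + num_degree k j Q"
proof -
  have NI: "nearest_neighbours k (I \<union> Q) y = nearest_neighbours k I y" if "y \<in> I" for y
    by (rule nearest_neighbours_separated[OF fin that]) (use sepI that in auto)
  have NO: "nearest_neighbours k (I \<union> Q) y = nearest_neighbours k Q y" if "y \<in> Q" for y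
    using nearest_neighbours_separated[of Q I y k] fin that sepO by (auto simp: Un_commute Int_commute)
  have sub: "nearest_neighbours k Y y \<subseteq> Y" for Y and y :: 'a
    by (auto simp: nearest_neighbours_def)
  have DI: "knn_degree k (I \<union> Q) y = knn_degree k I y" if "y \<in> I" for y
  proof -
    have "knn_adjacent k (I \<union> Q) y z = knn_adjacent k I y z" for z
      using NI NO sub[of I y] sub[of I z] sub[of Q z] fin(3) that unfolding knn_adjacent_def by blast
    then show ?thesis by (simp add: knn_degree_def)
  qed
  have DO: "knn_degree k (I \<union> Q) y = knn_degree k Q y" if "y \<in> Q" for y
  proof -
    have "knn_adjacent k (I \<union> Q) y z = knn_adjacent k Q y z" for z
      using NI NO sub[of Q y] sub[of I z] sub[of Q z] fin(3) that unfolding knn_adjacent_def by blast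
    then show ?thesis by (simp add: knn_degree_def)
  qed
  have "{y \<in> I \<union> Q. knn_degree k (I \<union> Q) y = j} =
        {y \<in> I. knn_degree k I y = j} \<union> {y \<in> Q. knn_degree k Q y = j}"
    using DI DO by auto
  then show ?thesis
    unfolding num_degree_def using fin
    by (simp add: card_Un_disjoint disjoint_iff)
qed

lemma num_degree_similarity:
  fixes T :: "'a::metric_space \<Rightarrow> 'b::metric_space"
  assumes h: "h > 0" and T: "\<And>x y. dist (T x) (T y) = h * dist x y"
  shows "num_degree k j (T ` X) = num_degree k j X"
proof -
  have inj: "inj T"
    using T h by (auto intro!: injI) (metis dist_eq_0_iff mult_eq_0_iff less_irrefl)
  have N: "T z \<in> nearest_neighbours k (T ` X) (T y) \<longleftrightarrow> z \<in> nearest_neighbours k X y" for y z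
  proof -
    have "cball (T y) (dist (T y) (T z)) \<inter> (T ` X - {T y}) = T ` (cball y (dist y z) \<inter> (X - {y}))"
      using h by (auto simp: T inj_eq[OF inj] image_iff)
    then have "card (cball (T y) (dist (T y) (T z)) \<inter> (T ` X - {T y})) =
        card (cball y (dist y z) \<inter> (X - {y}))"
      using inj by (simp add: card_image inj_on_subset)
    then show ?thesis
      by (auto simp: nearest_neighbours_def inj_eq[OF inj] image_iff)
  qed
  have "{z. knn_adjacent k (T ` X) (T y) z} = T ` {z. knn_adjacent k X y z}" for y
    by (auto simp: knn_adjacent_def N inj_eq[OF inj] image_iff)
  then have D: "knn_degree k (T ` X) (T y) = knn_degree k X y" for y
    unfolding knn_degree_def using inj by (simp add: card_image inj_on_subset)
  have "{y \<in> T ` X. knn_degree k (T ` X) y = j} = T ` {y \<in> X. knn_degree k X y = j}"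
    using D by auto
  then show ?thesis
    unfolding num_degree_def using inj by (simp add: card_image inj_on_subset)
qed

text \<open>The contribution of a vertex depends on its degree alone, which allows a pattern to be
  evaluated vertex by vertex.\<close>

lemma sum_num_degree:
  assumes "finite X" "finite J"
  shows "(\<Sum>i\<in>J. \<alpha> i * real (num_degree k (j i) X)) =
    (\<Sum>x\<in>X. \<Sum>i\<in>J. if j i = knn_degree k X x then \<alpha> i else 0)"
proof -
  have "\<alpha> i * real (num_degree k (j i) X) = (\<Sum>x\<in>X. if j i = knn_degree k X x then \<alpha> i else 0)" for i
    using assms(1)
    by (simp add: num_degree_def sum.If_cases eq_commute Int_def mult.commute)
  then show ?thesis
    by (simp add: sum.swap[of _ X])
qed

section \<open>Separated directions at a vertex\<close>

text \<open>Unit vectors at distance at most 1 span an angle of at most 60 degrees, and by the law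
  of cosines the side opposite such an angle is at most as long as the longer adjacent side.\<close>

lemma dist_le_norm_of_sgn_dist:
  fixes v w :: "'a::real_inner"
  assumes "v \<noteq> 0" "w \<noteq> 0" "norm v \<le> norm w" "dist (sgn v) (sgn w) \<le> 1"
  shows "dist v w \<le> norm w"
proof -
  have "(dist (sgn v) (sgn w))\<^sup>2 \<le> 1"
    using assms(4) by (simp add: power_le_one)
  moreover have "(dist (sgn v) (sgn w))\<^sup>2 = (norm (sgn v))\<^sup>2 + (norm (sgn w))\<^sup>2 - 2 * (sgn v \<bullet> sgn w)"
    unfolding dist_norm power2_norm_eq_inner by (simp add: inner_diff inner_commute)
  ultimately have c: "sgn v \<bullet> sgn w \<ge> 1/2"
    using assms(1,2) by (simp add: norm_sgn)
  have vw: "v \<bullet> w = norm v * norm w * (sgn v \<bullet> sgn w)"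
    using assms(1,2) by (simp add: sgn_div_norm field_simps)
  have "v \<bullet> w \<ge> norm v * norm w * (1/2)"
    unfolding vw using c by (intro mult_left_mono) auto
  moreover have "(dist v w)\<^sup>2 = (norm v)\<^sup>2 + (norm w)\<^sup>2 - 2 * (v \<bullet> w)"
    unfolding dist_norm power2_norm_eq_inner by (simp add: inner_diff inner_commute)
  ultimately have "(dist v w)\<^sup>2 \<le> (norm v)\<^sup>2 + (norm w)\<^sup>2 - norm v * norm w"
    by simp
  also have "\<dots> \<le> (norm w)\<^sup>2"
    using mult_left_mono[OF assms(3), of "norm v"] by (simp add: power2_eq_square)
  finally show ?thesis by (rule power2_le_imp_le) simp
qed

text \<open>Greedy choice: for a neighbour \<open>z\<close> of \<open>y\<close> farthest from \<open>y\<close>, at most \<open>k\<close> neighbours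
  have a direction within distance 1 of that of \<open>z\<close>.\<close>

lemma separated_directions:
  fixes X :: "'a::real_inner set"
  assumes "finite X" "k \<ge> 1" "A \<subseteq> {z. knn_adjacent k X y z}"
  shows "\<exists>U. finite U \<and> U \<subseteq> (\<lambda>z. sgn (z - y)) ` A \<and>
    (\<forall>u\<in>U. \<forall>v\<in>U. u \<noteq> v \<longrightarrow> dist u v > 1) \<and> card A \<le> k * card U"
  using assms(3)
proof (induction "card A" arbitrary: A rule: less_induct)
  case less
  have AX: "A \<subseteq> X - {y}" using less.prems by (auto simp: knn_adjacent_def)
  then have fA: "finite A" using assms(1) finite_subset by blast
  show ?case
  proof (cases "A = {}")
    case True then show ?thesis by (intro exI[of _ "{}"]) auto
  next
    case False
    obtain z where "z \<in> A" "Max (dist y ` A) = dist y z"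
      using obtains_MAX[OF fA False] by metis
    then have z: "z \<in> A" "\<And>w. w \<in> A \<Longrightarrow> dist y w \<le> dist y z"
      using fA Max_ge[of "dist y ` A"] by auto
    define D where "D = {w \<in> A. dist (sgn (w - y)) (sgn (z - y)) \<le> 1}"
    have zD: "z \<in> D" using z by (simp add: D_def)
    have fD: "finite D" using fA by (simp add: D_def)
    have yX: "y \<in> X" using less.prems z(1) by (auto simp: knn_adjacent_def)
    \<comment> \<open>If \<open>z\<close> selects \<open>y\<close>, the closed ball around
      \<open>z\<close> through \<open>y\<close> contains \<open>y\<close> and, by the 60 degree
      bound, the rest of \<open>D\<close>; \<open>y\<close> takes the place of \<open>z\<close> in
      the count. Otherwise \<open>y\<close> selects \<open>z\<close>, and the closed ball around
      \<open>y\<close> through \<open>z\<close> contains \<open>D\<close> because \<open>z\<close>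
      is farthest. Either ball holds at most \<open>k\<close> points.\<close>
    have cD: "card D \<le> k"
    proof (cases "y \<in> nearest_neighbours k X z")
      case True
      have "D - {z} \<union> {y} \<subseteq> cball z (dist z y) \<inter> (X - {z})"
      proof
        fix w assume w: "w \<in> D - {z} \<union> {y}"
        show "w \<in> cball z (dist z y) \<inter> (X - {z})"
        proof (cases "w = y")
          case True then show ?thesis using yX AX z(1) by auto
        next
          case False
          then have wD: "w \<in> D" "w \<noteq> z" using w by auto
          then have wA: "w \<in> A" by (simp add: D_def)
          have "dist (w - y) (z - y) \<le> norm (z - y)"
            using wD wA AX z z(2)[OF wA]
            by (intro dist_le_norm_of_sgn_dist) (auto simp: D_def dist_norm norm_minus_commute)
          then show ?thesis using wA wD AX by (auto simp: dist_norm norm_minus_commute)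
        qed
      qed
      then have "card (D - {z} \<union> {y}) \<le> card (cball z (dist z y) \<inter> (X - {z}))"
        using assms(1) by (intro card_mono) auto
      also have "\<dots> \<le> k" using True by (simp add: nearest_neighbours_def)
      finally show ?thesis
        using fD zD AX by (subst (asm) card_Un_disjoint) (auto simp: D_def card_Suc_Diff1)
    next
      case False
      then have "z \<in> nearest_neighbours k X y"
        using less.prems z(1) by (auto simp: knn_adjacent_def)
      moreover have "D \<subseteq> cball y (dist y z) \<inter> (X - {y})"
        using z AX by (auto simp: D_def)
      ultimately show ?thesis
        using card_mono[of "cball y (dist y z) \<inter> (X - {y})" D] assms(1)
        by (auto simp: nearest_neighbours_def)
    qed
    have "card (A - D) < card A"
      using zD z(1) fA by (intro psubset_card_mono) blast+
    then obtain U where U: "finite U" "U \<subseteq> (\<lambda>z. sgn (z - y)) ` (A - D)"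
      "\<forall>u\<in>U. \<forall>v\<in>U. u \<noteq> v \<longrightarrow> dist u v > 1" "card (A - D) \<le> k * card U"
      using less.hyps[of "A - D"] less.prems by blast
    have far: "dist u (sgn (z - y)) > 1" if "u \<in> U" for u
      using U(2) that by (auto simp: D_def)
    have "sgn (z - y) \<notin> U" using far by force
    then have cU: "card (insert (sgn (z - y)) U) = Suc (card U)" using U(1) by simp
    have "card A \<le> card D + card (A - D)"
      using fA fD by (simp add: card_Diff_subset D_def)
    also have "\<dots> \<le> k * card (insert (sgn (z - y)) U)"
      using cD U(4) cU by simp
    finally show ?thesis
      using U far z(1)
      by (intro exI[of _ "insert (sgn (z - y)) U"]) (auto simp: dist_commute)
  qed
qed

text \<open>Pigeonhole: a ball of radius 1/2 contains at most one member of such a set. The bound is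
  what makes the set of occurring degrees finite, so that its maximum \<open>k_max\<close> is
  meaningful.\<close>

lemma separated_sphere_card_bound:
  "\<exists>K. \<forall>U :: 'a::euclidean_space set. finite U \<longrightarrow> (\<forall>u\<in>U. norm u = 1) \<longrightarrow>
    (\<forall>u\<in>U. \<forall>v\<in>U. u \<noteq> v \<longrightarrow> dist u v > 1) \<longrightarrow> card U \<le> K"
proof -
  obtain C where C: "finite C" "C \<subseteq> sphere (0::'a) 1" "sphere (0::'a) 1 \<subseteq> (\<Union>c\<in>C. ball c (1/2))"
    using compactE_image[OF compact_sphere[of "0::'a" 1], of "sphere 0 1" "\<lambda>c. ball c (1/2)"]
    by force
  have "card U \<le> card C" if "finite U" "\<forall>u\<in>U. norm u = 1"
    and sep: "\<forall>u\<in>U. \<forall>v\<in>U. u \<noteq> v \<longrightarrow> dist u v > 1" for U :: "'a set"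
  proof -
    have "\<forall>u\<in>U. \<exists>c\<in>C. u \<in> ball c (1/2)" using that C by (fastforce simp: sphere_def)
    then have "\<forall>u\<in>U. \<exists>c. c \<in> C \<and> dist c u < 1/2" by auto
    then obtain f where f: "\<forall>u\<in>U. f u \<in> C \<and> dist (f u) u < 1/2"
      unfolding bchoice_iff by blast
    have "inj_on f U"
    proof (rule inj_onI, rule ccontr)
      fix u v assume uv: "u \<in> U" "v \<in> U" "f u = f v" "u \<noteq> v"
      then show False
        using f sep dist_triangle_half_r[of "f u" u 1 v] by fastforce
    qed
    then show ?thesis using f C(1) by (intro card_inj_on_le[of f]) auto
  qed
  then show ?thesis by blast
qed

section \<open>The star with a centre of prescribed degree\<close>

text \<open>Cell 0 belongs to the centre, cells 1 to \<open>q\<close> to the full clusters, and the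
  direction \<open>u 0\<close> to the split cluster. Moving two points by less than \<delta> each
  changes their distance by less than 2\<delta>; the offset 5\<delta> thus keeps inner part, full
  clusters and outer part in three disjoint ranges of distance from the centre.\<close>

definition star_centre :: "(nat \<Rightarrow> 'a::real_normed_vector) \<Rightarrow> nat \<Rightarrow> real \<Rightarrow> nat \<Rightarrow> 'a" where
  "star_centre u q \<delta> i =
    (if i = 0 then 0 else if i \<le> q then u i
     else if i = Suc q then (1 - 5 * \<delta>) *\<^sub>R u 0 else (1 + 5 * \<delta>) *\<^sub>R u 0)"

text \<open>The two parts of the split cluster have \<open>Suc k\<close> points together, enough to
  be each other's neighbours. A full cluster has one point fewer, which forces its points to select
  the centre as well.\<close>

definition star_count :: "nat \<Rightarrow> nat \<Rightarrow> nat \<Rightarrow> nat \<Rightarrow> nat" where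
  "star_count k q t i =
    (if i = 0 then 1 else if i \<le> q then k else if i = Suc q then t else Suc k - t)"

text \<open>\<gamma> is the room left by directions more than 1 apart. A cell radius small against
  both \<gamma> and 1 makes every comparison of distances independent of where the points lie in
  their cells.\<close>

locale star =
  fixes u :: "nat \<Rightarrow> 'a::euclidean_space" and q :: nat and \<delta> \<gamma> :: real
  assumes unit: "\<And>i. i \<le> q \<Longrightarrow> norm (u i) = 1"
    and sep: "\<And>i l. i \<le> q \<Longrightarrow> l \<le> q \<Longrightarrow> i \<noteq> l \<Longrightarrow> 1 + \<gamma> \<le> dist (u i) (u l)"
    and \<delta>: "0 < \<delta>" "20 * \<delta> \<le> \<gamma>" "100 * \<delta> \<le> 1" and q: "q \<ge> 1"
begin

abbreviation "c \<equiv> star_centre u q \<delta>"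

lemma c_simps [simp]: "c 0 = 0" "c (Suc q) = (1 - 5 * \<delta>) *\<^sub>R u 0"
    "c (Suc (Suc q)) = (1 + 5 * \<delta>) *\<^sub>R u 0" "1 \<le> i \<Longrightarrow> i \<le> q \<Longrightarrow> c i = u i"
  by (auto simp: star_centre_def)

lemma dist_u0: "dist (u 0) ((1 - 5 * \<delta>) *\<^sub>R u 0) = 5 * \<delta>" "dist (u 0) ((1 + 5 * \<delta>) *\<^sub>R u 0) = 5 * \<delta>"
  "dist ((1 - 5 * \<delta>) *\<^sub>R u 0) ((1 + 5 * \<delta>) *\<^sub>R u 0) = 10 * \<delta>"
  using unit[of 0] \<delta> by (simp_all add: dist_norm flip: scaleR_diff_left) (simp_all add: algebra_simps)

lemma dist_c:
  "1 \<le> i \<Longrightarrow> i \<le> q \<Longrightarrow> dist 0 (u i) = 1"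
  "1 \<le> i \<Longrightarrow> i \<le> q \<Longrightarrow> 1 + 15 * \<delta> \<le> dist (u i) ((1 - 5 * \<delta>) *\<^sub>R u 0)"
  "1 \<le> i \<Longrightarrow> i \<le> q \<Longrightarrow> 1 + 15 * \<delta> \<le> dist (u i) ((1 + 5 * \<delta>) *\<^sub>R u 0)"
  "dist 0 ((1 - 5 * \<delta>) *\<^sub>R u 0) = 1 - 5 * \<delta>"
  "dist 0 ((1 + 5 * \<delta>) *\<^sub>R u 0) = 1 + 5 * \<delta>"
proof -
  assume i: "1 \<le> i" "i \<le> q"
  show "dist 0 (u i) = 1" using unit[OF i(2)] by simp
  have s: "1 + \<gamma> \<le> dist (u i) (u 0)" using sep[of i 0] i by simp
  show "1 + 15 * \<delta> \<le> dist (u i) ((1 - 5 * \<delta>) *\<^sub>R u 0)"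
    using dist_triangle[of "u i" "u 0" "(1 - 5 * \<delta>) *\<^sub>R u 0"] dist_u0 s \<delta>
    by (simp add: dist_commute)
  show "1 + 15 * \<delta> \<le> dist (u i) ((1 + 5 * \<delta>) *\<^sub>R u 0)"
    using dist_triangle[of "u i" "u 0" "(1 + 5 * \<delta>) *\<^sub>R u 0"] dist_u0 s \<delta>
    by (simp add: dist_commute)
next
  show "dist 0 ((1 - 5 * \<delta>) *\<^sub>R u 0) = 1 - 5 * \<delta>" "dist 0 ((1 + 5 * \<delta>) *\<^sub>R u 0) = 1 + 5 * \<delta>"
    using unit[of 0] \<delta> by auto
qed

lemma star_index_cases:
  assumes "i < q + 3"
  obtains "i = 0" | "1 \<le> i" "i \<le> q" | "i = Suc q" | "i = Suc (Suc q)"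
  using assms by linarith

lemma star_centres_apart:
  assumes "i < q + 3" "l < q + 3" "i \<noteq> l"
  shows "2 * \<delta> \<le> dist (c i) (c l)"
proof (rule star_index_cases[OF assms(1)]; rule star_index_cases[OF assms(2)])
qed (use assms(3) dist_c(1-3)[of i] dist_c(1-3)[of l] dist_c(4,5) dist_u0 \<delta> sep[of i l] in
      \<open>auto simp: dist_commute[of "(1 - 5 * \<delta>) *\<^sub>R u 0"] dist_commute[of "(1 + 5 * \<delta>) *\<^sub>R u 0"]
        simp flip: norm_conv_dist\<close>)

lemma star_ball_subset:
  assumes "i < q + 3" shows "ball (c i) \<delta> \<subseteq> ball 0 2"
proof
  fix x assume x: "x \<in> ball (c i) \<delta>"
  have "dist 0 (c i) \<le> 1 + 5 * \<delta>"
    by (rule star_index_cases[OF assms]) (use dist_c(1)[of i] dist_c(4,5) \<delta> in \<open>auto simp del: dist_0_norm\<close>)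
  then show "x \<in> ball 0 2"
    using x dist_triangle[of 0 x "c i"] \<delta> by (simp del: dist_0_norm)
qed

end

lemma dist_ball_ball:
  assumes "x \<in> ball a \<delta>" "y \<in> ball b \<delta>"
  shows "dist a b - 2 * \<delta> < dist x y" "dist x y < dist a b + 2 * \<delta>"
proof -
  show "dist a b - 2 * \<delta> < dist x y"
    using dist_triangle[of a b x] dist_triangle[of x b y] assms by (simp add: dist_commute)
  show "dist x y < dist a b + 2 * \<delta>"
    using dist_triangle[of x y a] dist_triangle[of a y b] assms by (simp add: dist_commute)
qed

context star
begin

text \<open>A point of a full cluster selects its k - 1 companions and the centre; points of the
  split cluster select one another only. The centre selects the inner part \<open>H\<close>, because
  only points of \<open>H\<close> are as close and there are t <= k of them, and it selects nothing
  in the outer part \<open>G\<close>, because q k + t > k points are closer. Whichever points of the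
  full clusters \<open>M\<close> it selects are adjacent to it anyway. Hence the degrees: q k + t at
  the centre, k + 1 on \<open>H\<close>, and k on \<open>M\<close> and \<open>G\<close>.\<close>

lemma star_degree_sum:
  fixes X :: "'a set" and \<beta> :: "nat \<Rightarrow> real"
  assumes k: "k \<ge> 1" and t: "1 \<le> t" "t \<le> k" and fX: "finite X"
    and cov: "X \<subseteq> (\<Union>i<q + 3. ball (c i) \<delta>)"
    and cnt: "\<And>i. i < q + 3 \<Longrightarrow> card (X \<inter> ball (c i) \<delta>) = star_count k q t i"
  shows "(\<Sum>x\<in>X. \<beta> (knn_degree k X x)) =
    \<beta> (q * k + t) + real t * \<beta> (Suc k) + real (q * k + (Suc k - t)) * \<beta> k"
proof -
  define Z where "Z i = X \<inter> ball (c i) \<delta>" for i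
  define M where "M = (\<Union>i\<in>{1..q}. Z i)"
  define H where "H = Z (Suc q)"
  define G where "G = Z (Suc (Suc q))"
  have fin: "finite (Z i)" "finite M" "finite H" "finite G" for i
    using fX by (auto simp: Z_def M_def H_def G_def)
  have disj: "Z i \<inter> Z l = {}" if "i < q + 3" "l < q + 3" "i \<noteq> l" for i l
    using dist_ball_ball(1)[of _ "c i" \<delta> _ "c l"] star_centres_apart[OF that]
    by (fastforce simp: Z_def)
  have card_Z: "card (Z i) = k" if "i \<in> {1..q}" for i
    using cnt[of i] that by (simp add: Z_def star_count_def)
  have card_H: "card H = t" and card_G: "card G = Suc k - t"
    using cnt[of "Suc q"] cnt[of "Suc (Suc q)"] by (simp_all add: Z_def H_def G_def star_count_def)
  have "card (Z 0) = 1"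
    using cnt[of 0] by (simp add: Z_def star_count_def)
  then obtain y where y: "Z 0 = {y}" by (auto simp: card_1_singleton_iff)
  have card_M: "card M = q * k"
    unfolding M_def using fin disj card_Z
    by (subst card_UN_disjoint) auto
  have X_eq: "X = insert y (M \<union> H \<union> G)"
  proof
    show "X \<subseteq> insert y (M \<union> H \<union> G)"
    proof
      fix x assume "x \<in> X"
      then obtain i where i: "i < q + 3" "x \<in> Z i" using cov by (auto simp: Z_def)
      show "x \<in> insert y (M \<union> H \<union> G)"
        by (rule star_index_cases[OF i(1)]) (use i y in \<open>auto simp: M_def H_def G_def\<close>)
    qed
    show "insert y (M \<union> H \<union> G) \<subseteq> X" using y by (auto simp: M_def H_def G_def Z_def)
  qed
  have yZ: "y \<in> Z 0" using y by simp
  have MZ: "M \<inter> Z l = {}" if "l = 0 \<or> l = Suc q \<or> l = Suc (Suc q)" for l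
  proof -
    have "Z i \<inter> Z l = {}" if "i \<in> {1..q}" for i
      using disj[of i l] that \<open>l = 0 \<or> _\<close> by auto
    then show ?thesis unfolding M_def by blast
  qed
  have "y \<notin> M" using yZ MZ[of 0] by blast
  moreover have "y \<notin> H" "y \<notin> G" "H \<inter> G = {}"
    using yZ disj[of 0 "Suc q"] disj[of 0 "Suc (Suc q)"] disj[of "Suc q" "Suc (Suc q)"]
    by (auto simp: H_def G_def)
  moreover have "M \<inter> H = {}" "M \<inter> G = {}"
    using MZ by (auto simp: H_def G_def)
  ultimately have dj: "y \<notin> M" "y \<notin> H" "y \<notin> G" "M \<inter> H = {}" "M \<inter> G = {}" "H \<inter> G = {}"
    by blast+
  have inB: "x \<in> Z i \<Longrightarrow> x \<in> ball (c i) \<delta>" for x i by (simp add: Z_def)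
  have y0: "y \<in> ball 0 \<delta>" using inB[of y 0] y by simp
  have dyM: "1 - 2 * \<delta> < dist y z" "dist y z < 1 + 2 * \<delta>" if zM: "z \<in> M" for z
  proof -
    obtain i where i: "i \<in> {1..q}" "z \<in> Z i" using zM unfolding M_def by blast
    show "1 - 2 * \<delta> < dist y z" "dist y z < 1 + 2 * \<delta>"
      using dist_ball_ball[OF y0 inB[OF i(2)]] dist_c(1)[of i] i(1) by auto
  qed
  have dyH: "1 - 7 * \<delta> < dist y e" "dist y e < 1 - 3 * \<delta>" if "e \<in> H" for e
    using dist_ball_ball[OF y0 inB[of e "Suc q"]] dist_c(4) that by (auto simp: H_def)
  have dyG: "1 + 3 * \<delta> < dist y e" if "e \<in> G" for e
    using dist_ball_ball[OF y0 inB[of e "Suc (Suc q)"]] dist_c(5) that by (auto simp: G_def)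
  have dZZ: "dist x z < 2 * \<delta>" if "x \<in> Z i" "z \<in> Z i" for x z i
    using dist_ball_ball(2)[OF inB[OF that(1)] inB[OF that(2)]] by simp
  have dZZ': "1 + 2 * \<delta> < dist x z" if "x \<in> Z i" "z \<in> Z l" "i \<in> {1..q}" "l \<in> {1..q}" "i \<noteq> l" for x z i l
    using dist_ball_ball(1)[OF inB[OF that(1)] inB[OF that(2)]] sep[of i l] that \<delta> by simp
  have dME: "1 + 2 * \<delta> < dist x e" if xM: "x \<in> M" and eE: "e \<in> H \<union> G" for x e
  proof -
    obtain i where i: "i \<in> {1..q}" "x \<in> Z i" using xM unfolding M_def by blast
    show ?thesis
      using dist_ball_ball(1)[OF inB[OF i(2)] inB[of e "Suc q"]]
        dist_ball_ball(1)[OF inB[OF i(2)] inB[of e "Suc (Suc q)"]] dist_c(2,3)[of i] i(1) eE \<delta>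
      by (auto simp: H_def G_def)
  qed
  have dEE: "dist e e' < 12 * \<delta>" if "e \<in> H \<union> G" "e' \<in> H \<union> G" for e e'
    using that dZZ[of e "Suc q" e'] dZZ[of e "Suc (Suc q)" e'] dist_u0(3) \<delta>
      dist_ball_ball(2)[OF inB[of e "Suc q"] inB[of e' "Suc (Suc q)"]]
      dist_ball_ball(2)[OF inB[of e' "Suc q"] inB[of e "Suc (Suc q)"]]
    by (auto simp: H_def G_def dist_commute)
  have NM: "nearest_neighbours k X z = insert y (Z i - {z})" if z: "z \<in> Z i" "i \<in> {1..q}" for z i
  proof (rule nearest_neighbours_eq[OF fX])
    have zM: "z \<in> M" using z by (auto simp: M_def)
    show "insert y (Z i - {z}) \<subseteq> X - {z}"
      using dj(1) zM X_eq by (auto simp: Z_def)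
    have "y \<notin> Z i" using dj(1) z by (auto simp: M_def)
    then show "card (insert y (Z i - {z})) = k"
      using fin(1)[of i] card_Z[OF z(2)] z(1) k by (simp add: card_Diff_singleton)
    fix a x assume a: "a \<in> insert y (Z i - {z})" and x: "x \<in> X - {z} - insert y (Z i - {z})"
    have "dist z a < 1 + 2 * \<delta>"
      using a dyM(2)[OF zM] dZZ[OF z(1), of a] \<delta> by (auto simp: dist_commute)
    moreover have "1 + 2 * \<delta> < dist z x"
    proof (cases "x \<in> M")
      case True
      then obtain l where "l \<in> {1..q}" "x \<in> Z l" unfolding M_def by blast
      then show ?thesis using dZZ'[OF z(1) _ z(2), of x l] x by auto
    next
      case False
      then show ?thesis using dME[OF zM, of x] x X_eq by auto
    qed
    ultimately show "dist z a < dist z x" by simp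
  qed
  have NE: "nearest_neighbours k X e = H \<union> G - {e}" if e: "e \<in> H \<union> G" for e
  proof (rule nearest_neighbours_eq[OF fX])
    show "H \<union> G - {e} \<subseteq> X - {e}" using X_eq by auto
    show "card (H \<union> G - {e}) = k"
      using e fin dj(6) card_H card_G t by (simp add: card_Diff_singleton card_Un_disjoint)
    fix a x assume a: "a \<in> H \<union> G - {e}" and x: "x \<in> X - {e} - (H \<union> G - {e})"
    have "dist e a < 12 * \<delta>" using a dEE[OF e] by auto
    moreover have "12 * \<delta> < dist e x"
      using x X_eq dyH(1)[of e] dyG[of e] dME[OF _ e, of x] e \<delta>
      by (auto simp: dist_commute)
    ultimately show "dist e a < dist e x" by simp
  qed
  have NyH: "H \<subseteq> nearest_neighbours k X y"
  proof
    fix e assume e: "e \<in> H"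
    have "cball y (dist y e) \<inter> (X - {y}) \<subseteq> H"
    proof
      fix x assume x: "x \<in> cball y (dist y e) \<inter> (X - {y})"
      have "x \<notin> M" using dyM(1)[of x] x dyH(2)[OF e] \<delta> by auto
      moreover have "x \<notin> G" using dyG[of x] x dyH(2)[OF e] \<delta> by auto
      ultimately show "x \<in> H" using x X_eq by auto
    qed
    then have "card (cball y (dist y e) \<inter> (X - {y})) \<le> k"
      using card_mono[OF fin(3), of "cball y (dist y e) \<inter> (X - {y})"] card_H t by simp
    then show "e \<in> nearest_neighbours k X y"
      using e dj X_eq by (auto simp: nearest_neighbours_def)
  qed
  have NyG: "nearest_neighbours k X y \<inter> G = {}"
  proof -
    have "e \<notin> nearest_neighbours k X y" if e: "e \<in> G" for e
    proof -
      have "dist y z \<le> dist y e" if "z \<in> M \<union> H" for z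
        using that
      proof
        assume "z \<in> M" then show ?thesis using dyG[OF e] dyM(2)[of z] \<delta> by simp
      next
        assume "z \<in> H" then show ?thesis using dyG[OF e] dyH(2)[of z] \<delta> by simp
      qed
      then have "M \<union> H \<subseteq> cball y (dist y e) \<inter> (X - {y})"
        using dj X_eq by auto
      then have "card (M \<union> H) \<le> card (cball y (dist y e) \<inter> (X - {y}))"
        using fX by (intro card_mono) auto
      \<comment> \<open>One full cluster accounts for \<open>k\<close> points and \<open>H\<close>
        for at least one more, which is where \<open>q\<close> and \<open>t\<close> being positive
        enters.\<close>
      moreover have "k < card (M \<union> H)"
      proof -
        have "card (M \<union> H) = q * k + t" using fin dj(4) card_M card_H by (simp add: card_Un_disjoint)
        moreover have "k \<le> q * k" using q by simp
        ultimately show ?thesis using t by arith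
      qed
      ultimately show ?thesis by (auto simp: nearest_neighbours_def)
    qed
    then show ?thesis by blast
  qed
  have Nsub: "nearest_neighbours k X y \<subseteq> X - {y}" by (auto simp: nearest_neighbours_def)
  have yN: "y \<in> nearest_neighbours k X z \<longleftrightarrow> z \<in> M" if z: "z \<in> X - {y}" for z
  proof (cases "z \<in> M")
    case True
    then obtain i where "i \<in> {1..q}" "z \<in> Z i" unfolding M_def by blast
    then show ?thesis using NM True by blast
  next
    case False
    then have "z \<in> H \<union> G" using z X_eq by blast
    then show ?thesis using NE dj False by blast
  qed
  have adj_y: "{z. knn_adjacent k X y z} = M \<union> H"
    using yN NyH NyG Nsub X_eq dj unfolding knn_adjacent_def by blast
  have adj_M: "{x. knn_adjacent k X z x} = insert y (Z i - {z})" if z: "z \<in> Z i" "i \<in> {1..q}" for z i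
  proof -
    have zM: "z \<in> M" using z by (auto simp: M_def)
    have "x \<in> insert y (Z i - {z})" if "x \<in> X" "x \<noteq> z" "z \<in> nearest_neighbours k X x" for x
    proof (cases "x \<in> M")
      case True
      then obtain l where l: "l \<in> {1..q}" "x \<in> Z l" unfolding M_def by blast
      have "z \<in> insert y (Z l - {x})" using that(3) NM[OF l(2,1)] by simp
      then have "z \<in> Z l" using dj(1) zM by auto
      then have "l = i" using disj[of l i] l(1) z by force
      then show ?thesis using l that by simp
    next
      case False
      then have "x = y \<or> x \<in> H \<union> G" using that X_eq by blast
      then show ?thesis using that NE[of x] dj zM by auto
    qed
    moreover have "z \<in> X" "z \<noteq> y" using zM X_eq dj by auto
    moreover have "insert y (Z i - {z}) \<subseteq> X" using yZ by (auto simp: Z_def)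
    ultimately show ?thesis by (auto simp: knn_adjacent_def NM[OF z])
  qed
  have adj_H: "{x. knn_adjacent k X e x} = insert y (H \<union> G - {e})" if e: "e \<in> H" for e
  proof -
    have eM: "e \<notin> nearest_neighbours k X x" if xM: "x \<in> M" for x
    proof -
      obtain i where i: "i \<in> {1..q}" "x \<in> Z i" using xM unfolding M_def by blast
      then have "e \<notin> Z i" using e dj unfolding M_def by blast
      then show ?thesis using NM[OF i(2,1)] e dj by auto
    qed
    have *: "e \<in> X" "e \<noteq> y" "insert y (H \<union> G - {e}) \<subseteq> X" "e \<in> nearest_neighbours k X y"
      using e X_eq dj NyH by auto
    have "x \<in> insert y (H \<union> G - {e})" if "x \<in> X" "x \<noteq> e" "e \<in> nearest_neighbours k X x" for x
      using eM[of x] that X_eq by blast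
    then show ?thesis using NE[of e] e * by (auto simp: knn_adjacent_def)
  qed
  have adj_G: "{x. knn_adjacent k X e x} = H \<union> G - {e}" if e: "e \<in> G" for e
  proof -
    have eM: "e \<notin> nearest_neighbours k X x" if xM: "x \<in> M" for x
    proof -
      obtain i where i: "i \<in> {1..q}" "x \<in> Z i" using xM unfolding M_def by blast
      then have "e \<notin> Z i" using e dj unfolding M_def by blast
      then show ?thesis using NM[OF i(2,1)] e dj by auto
    qed
    have *: "e \<in> X" "H \<union> G \<subseteq> X" "e \<notin> nearest_neighbours k X y"
      using e X_eq NyG by auto
    have "x \<in> H \<union> G - {e}" if "x \<in> X" "x \<noteq> e" "e \<in> nearest_neighbours k X x" for x
      using eM[of x] that X_eq *(3) by blast
    then show ?thesis using NE[of e] e * by (auto simp: knn_adjacent_def)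
  qed
  have "knn_degree k X y = q * k + t"
    unfolding knn_degree_def adj_y using fin dj card_M card_H by (simp add: card_Un_disjoint)
  moreover have "knn_degree k X z = k" if zM: "z \<in> M" for z
  proof -
    obtain i where i: "i \<in> {1..q}" "z \<in> Z i" using zM unfolding M_def by blast
    have "y \<notin> Z i" using dj i by (auto simp: M_def)
    then show ?thesis
      unfolding knn_degree_def adj_M[OF i(2,1)]
      using fin(1)[of i] card_Z[OF i(1)] i k by (simp add: card_Diff_singleton)
  qed
  moreover have "knn_degree k X e = Suc k" if "e \<in> H" for e
    unfolding knn_degree_def adj_H[OF that]
    using that fin dj card_H card_G t by (simp add: card_Diff_singleton card_Un_disjoint)
  moreover have "knn_degree k X e = k" if "e \<in> G" for e
    unfolding knn_degree_def adj_G[OF that]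
    using that fin dj card_H card_G t by (simp add: card_Diff_singleton card_Un_disjoint)
  ultimately have deg: "knn_degree k X y = q * k + t" "\<And>z. z \<in> M \<Longrightarrow> knn_degree k X z = k"
    "\<And>z. z \<in> H \<Longrightarrow> knn_degree k X z = Suc k" "\<And>z. z \<in> G \<Longrightarrow> knn_degree k X z = k"
    by blast+
  have "(\<Sum>x\<in>insert y (M \<union> H \<union> G). \<beta> (knn_degree k X x)) =
    \<beta> (knn_degree k X y) + (\<Sum>x\<in>M. \<beta> (knn_degree k X x)) + (\<Sum>x\<in>H. \<beta> (knn_degree k X x))
      + (\<Sum>x\<in>G. \<beta> (knn_degree k X x))"
    using fin dj by (simp add: sum.union_disjoint Int_Un_distrib2)
  also have "\<dots> = \<beta> (q * k + t) + real t * \<beta> (Suc k) + real (q * k + (Suc k - t)) * \<beta> k"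
    by (simp add: deg card_M card_H card_G algebra_simps)
  finally show ?thesis using X_eq by simp
qed

end

lemma complete_degree_sum:
  fixes X :: "'a::metric_space set" and \<beta> :: "nat \<Rightarrow> real"
  assumes "card X = Suc k"
  shows "(\<Sum>x\<in>X. \<beta> (knn_degree k X x)) = real (Suc k) * \<beta> k"
proof -
  have fX: "finite X" using assms by (metis card.infinite nat.distinct(1))
  have N: "nearest_neighbours k X y = X - {y}" if "y \<in> X" for y
    by (rule nearest_neighbours_eq[OF fX]) (use assms that in auto)
  have "{z. knn_adjacent k X y z} = X - {y}" if "y \<in> X" for y
    using N that by (auto simp: knn_adjacent_def)
  then have "knn_degree k X y = k" if "y \<in> X" for y
    using that assms fX by (simp add: knn_degree_def)
  then show ?thesis using assms by simp
qed

section \<open>Inner pattern and shielding shell\<close>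

text \<open>Everything is expressed by counts in disjoint sets, whose joint law a Poisson process
  prescribes. With \<open>m = 0\<close> the condition says that \<open>X\<close> has no point in
  \<open>R\<close>; the event of an empty ball is obtained in this way.\<close>

definition matches :: "nat \<Rightarrow> (nat \<Rightarrow> 'a::metric_space) \<Rightarrow> real \<Rightarrow> (nat \<Rightarrow> nat) \<Rightarrow> 'a set \<Rightarrow> 'a set \<Rightarrow> bool" where
  "matches m c \<delta> n R X \<longleftrightarrow>
    X \<inter> R \<subseteq> (\<Union>i<m. ball (c i) \<delta>) \<and> (\<forall>i<m. card (X \<inter> ball (c i) \<delta>) = n i)"

definition cells_in :: "nat \<Rightarrow> (nat \<Rightarrow> 'a::metric_space) \<Rightarrow> real \<Rightarrow> 'a set \<Rightarrow> bool" where
  "cells_in m c \<delta> R \<longleftrightarrow> 0 < \<delta> \<and> (\<forall>i<m. ball (c i) \<delta> \<subseteq> R) \<and>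
    (\<forall>i<m. \<forall>l<m. i \<noteq> l \<longrightarrow> ball (c i) \<delta> \<inter> ball (c l) \<delta> = {})"

lemma finite_gap:
  fixes a :: real
  assumes "finite S" "\<And>x. x \<in> S \<Longrightarrow> a < x"
  obtains e where "e > 0" "\<And>x. x \<in> S \<Longrightarrow> a + e \<le> x"
proof
  \<comment> \<open>Inserting 1 keeps the minimum defined when \<open>S\<close> is empty.\<close>
  show "Min (insert 1 ((\<lambda>x. x - a) ` S)) > 0" using assms by (auto simp: Min_gr_iff)
  show "a + Min (insert 1 ((\<lambda>x. x - a) ` S)) \<le> x" if "x \<in> S" for x
  proof -
    have "Min (insert 1 ((\<lambda>x. x - a) ` S)) \<le> x - a" using assms(1) that by (intro Min_le) auto
    then show ?thesis by linarith
  qed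
qed

lemma ball_disjointI:
  fixes x y :: "'a::metric_space"
  assumes "2 * \<delta> \<le> dist x y" shows "ball x \<delta> \<inter> ball y \<delta> = {}"
  using dist_triangle_half_r[of _ x "2 * \<delta>" y] assms by (force simp: dist_commute)

text \<open>Minimality of \<open>D\<close> excludes cancellation: \<beta> vanishes at
  \<open>k\<close> if \<open>k < D\<close>, and at \<open>Suc k\<close> unless
  \<open>D = Suc k\<close>, in which case the vertices of degree \<open>Suc k\<close> only enlarge
  the multiple of \<open>\<beta> D\<close>. The clause \<open>k < card X\<close> gives every inner
  point enough neighbours inside the ball, as shielding demands.\<close>

lemma inner_pattern_exists:
  fixes U :: "'a::euclidean_space set" and \<beta> :: "nat \<Rightarrow> real"
  assumes k: "k \<ge> 1" and U: "finite U" "\<And>u. u \<in> U \<Longrightarrow> norm u = 1"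
    "\<And>u v. u \<in> U \<Longrightarrow> v \<in> U \<Longrightarrow> u \<noteq> v \<Longrightarrow> 1 < dist u v"
    and D: "k \<le> D" "D \<le> k * card U" "\<beta> D \<noteq> 0" "\<And>i. i < D \<Longrightarrow> \<beta> i = 0"
  shows "\<exists>m (c :: nat \<Rightarrow> 'a) \<delta> n f. cells_in m c \<delta> (ball 0 2) \<and> f \<noteq> 0 \<and>
    (\<forall>X. finite X \<longrightarrow> X \<subseteq> ball 0 2 \<longrightarrow> matches m c \<delta> n (ball 0 2) X \<longrightarrow>
      k < card X \<and> (\<Sum>x\<in>X. \<beta> (knn_degree k X x)) = f)"
proof (cases "D = k")
  case True
  have "cells_in 1 (\<lambda>_. 0::'a) 1 (ball 0 2)" by (auto simp: cells_in_def)
  moreover have "real (Suc k) * \<beta> k \<noteq> 0" using D True by simp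
  moreover have "k < card X \<and> (\<Sum>x\<in>X. \<beta> (knn_degree k X x)) = real (Suc k) * \<beta> k"
    if "X \<subseteq> ball 0 2" "matches 1 (\<lambda>_. 0::'a) 1 (\<lambda>_. Suc k) (ball 0 2) X" for X
  proof -
    have "X \<inter> ball 0 1 = X" using that by (auto simp: matches_def lessThan_Suc Int_absorb2)
    then have "card X = Suc k" using that by (simp add: matches_def)
    then show ?thesis using complete_degree_sum[of X k \<beta>] by simp
  qed
  ultimately show ?thesis by blast
next
  case False
  then have kD: "k < D" using D by simp
  \<comment> \<open>Dividing \<open>D - 1\<close> rather than \<open>D\<close> gives a
    \<open>t\<close> between 1 and \<open>k\<close>, so that the inner part of the split cluster is
    never empty. The star uses \<open>q + 1\<close> directions, and
    \<open>D \<le> k * card U\<close> provides them.\<close>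
  define q where "q = (D - 1) div k"
  define t where "t = Suc ((D - 1) mod k)"
  have Dq: "D = q * k + t" using kD by (simp add: q_def t_def)
  have t: "1 \<le> t" "t \<le> k" using k by (auto simp: t_def Suc_leI)
  have q1: "q \<ge> 1" using kD k by (simp add: q_def div_greater_zero_iff Suc_leI)
  have qU: "q < card U" using D(2) kD k by (simp add: q_def less_mult_imp_div_less mult.commute)
  obtain u where u: "bij_betw u {0..<card U} U" using ex_bij_betw_nat_finite[OF U(1)] by blast
  have uU: "u i \<in> U" if "i \<le> q" for i using u that qU by (auto simp: bij_betw_def)
  have u_inj: "u i \<noteq> u l" if "i \<le> q" "l \<le> q" "i \<noteq> l" for i l
    using bij_betw_imp_inj_on[OF u] that qU by (auto simp: inj_on_def)
  obtain \<gamma> where \<gamma>: "\<gamma> > 0"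
    "\<And>x. x \<in> (\<lambda>(u, v). dist u v) ` (U \<times> U - Id) \<Longrightarrow> 1 + \<gamma> \<le> x"
    by (rule finite_gap[of "(\<lambda>(u, v). dist u v) ` (U \<times> U - Id)" 1]) (use U in auto)
  define \<delta> where "\<delta> = min (\<gamma> / 20) (1 / 100)"
  interpret star u q \<delta> \<gamma>
  proof
    show "norm (u i) = 1" if "i \<le> q" for i using U(2) uU that by simp
    show "1 + \<gamma> \<le> dist (u i) (u l)" if "i \<le> q" "l \<le> q" "i \<noteq> l" for i l
      by (rule \<gamma>(2)) (use uU u_inj that in auto)
    show "0 < \<delta>" "20 * \<delta> \<le> \<gamma>" "100 * \<delta> \<le> 1" using \<gamma>(1) by (auto simp: \<delta>_def)
  qed (fact q1)
  define f where "f = \<beta> D + real t * \<beta> (Suc k)"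
  have "cells_in (q + 3) c \<delta> (ball 0 2)"
    unfolding cells_in_def
    using \<delta>(1) star_ball_subset star_centres_apart ball_disjointI by metis
  moreover have "f \<noteq> 0"
  proof (cases "D = Suc k")
    case True
    then have "f = (1 + real t) * \<beta> D" by (simp add: f_def algebra_simps)
    then show ?thesis using D(3) by simp
  next
    case False
    then show ?thesis using D(3) D(4)[of "Suc k"] kD by (simp add: f_def)
  qed
  moreover have "k < card X \<and> (\<Sum>x\<in>X. \<beta> (knn_degree k X x)) = f"
    if X: "finite X" "X \<subseteq> ball 0 2" "matches (q + 3) c \<delta> (star_count k q t) (ball 0 2) X" for X
  proof -
    have cov: "X \<subseteq> (\<Union>i<q + 3. ball (c i) \<delta>)"
      using X(2,3) by (auto simp: matches_def)
    have cnt: "card (X \<inter> ball (c i) \<delta>) = star_count k q t i" if "i < q + 3" for i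
      using X(3) that by (simp add: matches_def)
    have "real (card X) = 1 + real t + real (q * k + (Suc k - t))"
      using star_degree_sum[OF k t X(1) cov cnt, of "\<lambda>_. 1"] by simp
    then have "card X = q * k + Suc (Suc k)" using t by linarith
    moreover have "(\<Sum>x\<in>X. \<beta> (knn_degree k X x)) = f"
      using star_degree_sum[OF k t X(1) cov cnt, of \<beta>] D(4)[OF kD] by (simp add: f_def Dq)
    ultimately show ?thesis by simp
  qed
  ultimately show ?thesis by blast
qed

text \<open>Compactness supplies a finite net of the unit sphere. Its mesh 1/2 becomes 5 at radius
  10, which is what the estimate in \<open>shielded_num_degree\<close> can afford.\<close>

lemma shield_exists:
  "\<exists>m (w :: nat \<Rightarrow> 'a::euclidean_space) \<delta>. (\<forall>x. norm x = 1 \<longrightarrow> (\<exists>i<m. dist x (w i) < 1/2)) \<and>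
     (\<forall>i<m. norm (w i) = 1) \<and> \<delta> \<le> 1 \<and>
     cells_in m (\<lambda>i. 10 *\<^sub>R w i) \<delta> (ball 0 12 - ball 0 2)"
proof -
  obtain C where C: "finite C" "C \<subseteq> sphere (0::'a) 1" "sphere (0::'a) 1 \<subseteq> (\<Union>c\<in>C. ball c (1/2))"
    using compactE_image[OF compact_sphere[of "0::'a" 1], of "sphere 0 1" "\<lambda>c. ball c (1/2)"]
    by force
  obtain w where w: "bij_betw w {0..<card C} C" using ex_bij_betw_nat_finite[OF C(1)] by blast
  have wC: "w i \<in> C" if "i < card C" for i using w that by (auto simp: bij_betw_def)
  have w1: "norm (w i) = 1" if "i < card C" for i using wC[OF that] C(2) by auto
  obtain e where e: "e > 0" "\<And>x. x \<in> (\<lambda>(u, v). dist u v) ` (C \<times> C - Id) \<Longrightarrow> 0 + e \<le> x"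
    by (rule finite_gap[of "(\<lambda>(u, v). dist u v) ` (C \<times> C - Id)" 0]) (use C in auto)
  define \<delta> where "\<delta> = min e 1"
  have \<delta>: "0 < \<delta>" "\<delta> \<le> 1" using e by (auto simp: \<delta>_def)
  have "ball (10 *\<^sub>R w i) \<delta> \<subseteq> ball 0 12 - ball 0 2" if "i < card C" for i
  proof
    fix x assume x: "x \<in> ball (10 *\<^sub>R w i) \<delta>"
    have "dist 0 (10 *\<^sub>R w i) = 10" using w1[OF that] by simp
    then show "x \<in> ball 0 12 - ball 0 2"
      using x \<delta> dist_triangle[of 0 x "10 *\<^sub>R w i"] dist_triangle[of 0 "10 *\<^sub>R w i" x]
      by (simp add: dist_commute del: dist_0_norm)
  qed
  moreover have "ball (10 *\<^sub>R w i) \<delta> \<inter> ball (10 *\<^sub>R w l) \<delta> = {}"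
    if "i < card C" "l < card C" "i \<noteq> l" for i l
  proof (rule ball_disjointI)
    have "w i \<noteq> w l" using bij_betw_imp_inj_on[OF w] that by (auto simp: inj_on_def)
    then have "e \<le> dist (w i) (w l)" using e(2)[of "dist (w i) (w l)"] wC that by auto
    moreover have "dist (10 *\<^sub>R w i) (10 *\<^sub>R w l) = 10 * dist (w i) (w l)"
      by (simp add: dist_norm flip: scaleR_diff_right)
    ultimately show "2 * \<delta> \<le> dist (10 *\<^sub>R w i) (10 *\<^sub>R w l)" using e by (auto simp: \<delta>_def)
  qed
  moreover have "\<exists>i<card C. dist x (w i) < 1/2" if x: "norm x = 1" for x
  proof -
    obtain y where y: "y \<in> C" "dist x y < 1/2" using C(3) x by (force simp: dist_commute)
    then have "y \<in> w ` {0..<card C}" using w by (simp add: bij_betw_def)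
    then obtain i where "i < card C" "w i = y" by auto
    then show ?thesis using y by auto
  qed
  ultimately show ?thesis using \<delta> w1 unfolding cells_in_def by blast
qed

text \<open>Every point has \<open>k\<close> points of its own side closer than any point of the
  other side. Inner points are within 4 of each other and more than 7 away from outer ones. A point
  of a shell cluster has its companions within 2 and is more than 7 away from inner points. Any
  other outer point y has norm at least 12; for x in a cluster within 1/2 of its direction, |y - x|
  < (|y| - 10) + 5 + 1 = |y| - 4, whereas inner points are farther than |y| - 2.\<close>

lemma shielded_num_degree:
  fixes X :: "'a::euclidean_space set"
  assumes fX: "finite X"
    and net: "\<And>x. norm x = 1 \<Longrightarrow> \<exists>i<m. dist x (w i) < 1/2" and w1: "\<And>i. i < m \<Longrightarrow> norm (w i) = 1"
    and \<delta>: "\<delta> \<le> 1"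
    and shield: "matches m (\<lambda>i. 10 *\<^sub>R w i) \<delta> (\<lambda>_. Suc k) (ball 0 12 - ball 0 2) X"
    and inner: "k < card (X \<inter> ball 0 2)"
  shows "num_degree k j X = num_degree k j (X \<inter> ball 0 2) + num_degree k j (X - ball 0 2)"
proof -
  let ?I = "X \<inter> ball 0 2" and ?E = "X - ball 0 2"
  let ?S = "\<lambda>i. X \<inter> ball (10 *\<^sub>R w i) \<delta>"
  have S10: "dist x (10 *\<^sub>R w i) < 1" "9 < norm x" if "x \<in> ?S i" "i < m" for x i
  proof -
    show d: "dist x (10 *\<^sub>R w i) < 1" using that \<delta> by (auto simp: dist_commute)
    then show "9 < norm x" using w1[OF that(2)] norm_triangle_sub[of "10 *\<^sub>R w i" x]
      by (simp add: dist_norm norm_minus_commute)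
  qed
  have SE: "?S i \<subseteq> ?E" if "i < m" for i using S10[OF _ that] by fastforce
  have E_cases: "(\<exists>i<m. y \<in> ?S i) \<or> 12 \<le> norm y" if "y \<in> ?E" for y
  proof (rule disjCI)
    assume "\<not> 12 \<le> norm y"
    then have "y \<in> X \<inter> (ball 0 12 - ball 0 2)" using that by auto
    then have "y \<in> (\<Union>i<m. ball (10 *\<^sub>R w i) \<delta>)" using shield unfolding matches_def by blast
    then show "\<exists>i<m. y \<in> ?S i" using that by blast
  qed
  have far: "9 < norm z" if "z \<in> ?E" for z
    using E_cases[OF that] S10 by fastforce
  have sepI: "k \<le> card {x \<in> ?I - {y}. dist y x < dist y z}" if y: "y \<in> ?I" and z: "z \<in> ?E" for y z
  proof -
    have "dist y x < dist y z" if x: "x \<in> ?I" for x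
    proof -
      have "dist y x < 4" using x y norm_triangle_ineq4[of y x] by (auto simp: dist_norm)
      moreover have "7 < dist y z"
        using far[OF z] y norm_triangle_sub[of z y] by (auto simp: dist_norm norm_minus_commute)
      ultimately show ?thesis by simp
    qed
    then have "{x \<in> ?I - {y}. dist y x < dist y z} = ?I - {y}" by auto
    then show ?thesis using inner y fX by simp
  qed
  have sepE: "k \<le> card {x \<in> ?E - {y}. dist y x < dist y z}" if y: "y \<in> ?E" and z: "z \<in> ?I" for y z
  proof -
    have "\<exists>i<m. \<forall>x\<in>?S i. dist y x < dist y z"
    proof (cases "\<exists>i<m. y \<in> ?S i")
      case True
      then obtain i where i: "i < m" "y \<in> ?S i" by blast
      have "dist y x < dist y z" if x: "x \<in> ?S i" for x
      proof -
        have "dist y x < 2"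
          using S10(1)[OF x i(1)] S10(1)[OF i(2,1)] dist_triangle[of y x "10 *\<^sub>R w i"]
          by (simp add: dist_commute)
        moreover have "7 < dist y z"
          using far[OF y] z norm_triangle_sub[of y z] by (auto simp: dist_norm norm_minus_commute)
        ultimately show ?thesis by simp
      qed
      then show ?thesis using i by blast
    next
      case False
      then have y12: "12 \<le> norm y" using E_cases[OF y] by blast
      then have y0: "y \<noteq> 0" by auto
      then have "norm (sgn y) = 1" by (simp add: norm_sgn)
      then obtain i where i: "i < m" "dist (sgn y) (w i) < 1/2" using net by blast
      have "dist y x < dist y z" if x: "x \<in> ?S i" for x
      proof -
        have "y - 10 *\<^sub>R sgn y = (1 - 10 / norm y) *\<^sub>R y"
          by (simp add: sgn_div_norm scaleR_diff_left divide_inverse)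
        then have "norm (y - 10 *\<^sub>R sgn y) = \<bar>1 - 10 / norm y\<bar> * norm y" by simp
        also have "\<dots> = norm y - 10" using y12 y0 by (simp add: field_simps abs_if)
        finally have "dist y (10 *\<^sub>R sgn y) = norm y - 10" by (simp add: dist_norm)
        moreover have "dist (10 *\<^sub>R sgn y) (10 *\<^sub>R w i) = 10 * dist (sgn y) (w i)"
          by (simp add: dist_norm flip: scaleR_diff_right)
        ultimately have "dist y x < norm y - 4"
          using i(2) S10(1)[OF x i(1)] dist_triangle[of y x "10 *\<^sub>R sgn y"]
            dist_triangle[of "10 *\<^sub>R sgn y" x "10 *\<^sub>R w i"]
          by (simp add: dist_commute)
        moreover have "norm y - 2 < dist y z"
          using z norm_triangle_sub[of y z] by (auto simp: dist_norm norm_minus_commute)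
        ultimately show ?thesis by simp
      qed
      then show ?thesis using i by blast
    qed
    then obtain i where i: "i < m" "\<forall>x\<in>?S i. dist y x < dist y z" by blast
    \<comment> \<open>The point \<open>y\<close> may itself belong to the cluster; \<open>k\<close>
      of the \<open>Suc k\<close> points remain.\<close>
    have "k \<le> card (?S i - {y})"
      using shield i(1) fX by (simp add: matches_def card_Diff_singleton_if)
    also have "\<dots> \<le> card {x \<in> ?E - {y}. dist y x < dist y z}"
      using SE[OF i(1)] i(2) fX by (intro card_mono) auto
    finally show ?thesis .
  qed
  have "num_degree k j (?I \<union> ?E) = num_degree k j ?I + num_degree k j ?E"
    using fX sepI sepE by (intro num_degree_separated) auto
  then show ?thesis by (simp add: Int_Diff_Un)
qed

section \<open>Measurability of degree counts\<close>

text \<open>The part of \<open>poisson_process\<close> that does not mention the intensity. It is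
  inherited when parameters are adjoined to the sample space, and when the configuration is
  restricted to a region together with the sigma-algebra.\<close>

definition random_config :: "'w measure \<Rightarrow> ('w \<Rightarrow> 'a::euclidean_space set) \<Rightarrow> bool" where
  "random_config M \<eta> \<longleftrightarrow>
     (\<forall>\<omega>\<in>space M. \<forall>B. bounded B \<longrightarrow> finite (\<eta> \<omega> \<inter> B)) \<and>
     (\<forall>B\<in>sets borel. (\<lambda>\<omega>. point_count (\<eta> \<omega>) B) \<in> borel_measurable M)"

lemma random_config_finite: "random_config M \<eta> \<Longrightarrow> \<omega> \<in> space M \<Longrightarrow> bounded B \<Longrightarrow> finite (\<eta> \<omega> \<inter> B)"
  and random_config_count:
    "random_config M \<eta> \<Longrightarrow> B \<in> sets borel \<Longrightarrow> (\<lambda>\<omega>. point_count (\<eta> \<omega>) B) \<in> borel_measurable M"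
  by (auto simp: random_config_def)

lemma random_config_fst:
  assumes "random_config M \<eta>" shows "random_config (M \<Otimes>\<^sub>M N) (\<lambda>p. \<eta> (fst p))"
  unfolding random_config_def
proof (intro conjI ballI allI impI)
  fix B :: "'b set" assume "B \<in> sets borel"
  then have "(\<lambda>\<omega>. point_count (\<eta> \<omega>) B) \<in> borel_measurable M"
    using assms by (simp add: random_config_def)
  then show "(\<lambda>p. point_count (\<eta> (fst p)) B) \<in> borel_measurable (M \<Otimes>\<^sub>M N)"
    by (rule measurable_compose[OF measurable_fst])
next
  fix p and B :: "'b set" assume "p \<in> space (M \<Otimes>\<^sub>M N)" "bounded B"
  then show "finite (\<eta> (fst p) \<inter> B)"
    using assms unfolding random_config_def space_pair_measure by auto
qed

lemma point_count_finite: "finite (X \<inter> B) \<Longrightarrow> point_count X B = of_nat (card (X \<inter> B))"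
  by (simp add: point_count_def)

text \<open>The uniform distribution on the points in a ball is a probability kernel, so that counts of
  points with a property depending on \<open>\<omega>\<close> are measurable.\<close>

lemma random_config_ecard:
  fixes \<eta> :: "'w \<Rightarrow> 'a::euclidean_space set"
  assumes \<eta>: "random_config M \<eta>"
    and T: "Measurable.pred (M \<Otimes>\<^sub>M borel) (\<lambda>p. T (fst p) (snd p))"
  shows "(\<lambda>\<omega>. emeasure (count_space UNIV) {x \<in> \<eta> \<omega>. T \<omega> x}) \<in> borel_measurable M"
proof -
  define S where "S r \<omega> = \<eta> \<omega> \<inter> ball 0 (real r)" for r \<omega>
  \<comment> \<open>The null measure for a ball without points makes \<open>K r\<close> a
    subprobability kernel on the whole sample space.\<close>
  define K where "K r \<omega> = (if S r \<omega> = {} then null_measure borel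
      else distr (measure_pmf (pmf_of_set (S r \<omega>))) borel (\<lambda>x. x))" for r \<omega>
  define A where "A \<omega> = {x. T \<omega> x}" for \<omega>
  have fin: "finite (S r \<omega>)" if "\<omega> \<in> space M" for r \<omega>
    using random_config_finite[OF \<eta> that] by (simp add: S_def)
  have SA: "(SIGMA \<omega>:space M. A \<omega>) \<in> sets (M \<Otimes>\<^sub>M borel)"
  proof -
    have "(SIGMA \<omega>:space M. A \<omega>) = {p \<in> space (M \<Otimes>\<^sub>M borel). T (fst p) (snd p)}"
      by (auto simp: A_def space_pair_measure)
    then show ?thesis using T by simp
  qed
  have A_sets: "A \<omega> \<in> sets borel" if "\<omega> \<in> space M" for \<omega>
  proof -
    have "A \<omega> = Pair \<omega> -` (SIGMA \<omega>:space M. A \<omega>)" using that by auto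
    then show ?thesis using sets_Pair1[OF SA] by simp
  qed
  have emK: "emeasure (K r \<omega>) B = point_count (\<eta> \<omega>) (ball 0 (real r) \<inter> B) / point_count (\<eta> \<omega>) (ball 0 (real r))"
    if "\<omega> \<in> space M" "B \<in> sets borel" for r \<omega> B
  proof (cases "S r \<omega> = {}")
    case True
    then have "point_count (\<eta> \<omega>) (ball 0 (real r) \<inter> B) = 0"
      by (auto simp: point_count_def S_def Int_assoc[symmetric])
    then show ?thesis using True by (simp add: K_def)
  next
    case False
    have f: "finite (\<eta> \<omega> \<inter> ball 0 (real r))" using fin[OF that(1), of r] by (simp add: S_def)
    have "point_count (\<eta> \<omega>) (ball 0 (real r) \<inter> B) = of_nat (card (S r \<omega> \<inter> B))"
      using f point_count_finite[of "\<eta> \<omega>" "ball 0 (real r) \<inter> B"] by (simp add: S_def Int_assoc[symmetric])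
    moreover have "point_count (\<eta> \<omega>) (ball 0 (real r)) = of_nat (card (S r \<omega>))"
      using f by (simp add: point_count_finite S_def)
    moreover have "emeasure (K r \<omega>) B = ennreal (real (card (S r \<omega> \<inter> B)) / real (card (S r \<omega>)))"
      using False that(2) fin[OF that(1)] by (simp add: K_def emeasure_distr emeasure_pmf_of_set)
    moreover have "card (S r \<omega>) > 0" using False fin[OF that(1)] by (simp add: card_gt_0_iff)
    ultimately show ?thesis
      by (simp add: divide_ennreal[symmetric] ennreal_of_nat_eq_real_of_nat)
  qed
  have K_meas: "K r \<in> measurable M (subprob_algebra borel)" for r
  proof (rule measurable_subprob_algebra)
    fix \<omega> assume w: "\<omega> \<in> space M"
    show "subprob_space (K r \<omega>)"
    proof (cases "S r \<omega> = {}")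
      case True
      then show ?thesis unfolding K_def by (simp add: subprob_space_null_measure)
    next
      case False
      have "prob_space (distr (measure_pmf (pmf_of_set (S r \<omega>))) borel (\<lambda>x. x))"
        by (rule prob_space.prob_space_distr[OF prob_space_measure_pmf]) simp
      then show ?thesis using False unfolding K_def by (simp add: prob_space_imp_subprob_space)
    qed
    show "sets (K r \<omega>) = sets borel" by (simp add: K_def)
  next
    fix B :: "'a set" assume B [measurable]: "B \<in> sets borel"
    have "(\<lambda>\<omega>. point_count (\<eta> \<omega>) (ball 0 (real r) \<inter> B) / point_count (\<eta> \<omega>) (ball 0 (real r)))
        \<in> borel_measurable M"
      using \<eta> by (intro borel_measurable_divide_ennreal random_config_count) auto
    then show "(\<lambda>\<omega>. emeasure (K r \<omega>) B) \<in> borel_measurable M"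
      by (subst measurable_cong[OF emK]) (auto simp: B)
  qed
  \<comment> \<open>Multiplying by the total number of points turns the kernel back into a count; a
    kernel evaluated on the sections of a measurable subset of the product is measurable.\<close>
  have count: "emeasure (count_space UNIV) {x \<in> S r \<omega>. T \<omega> x} =
      point_count (\<eta> \<omega>) (ball 0 (real r)) * emeasure (K r \<omega>) (A \<omega>)" if w: "\<omega> \<in> space M" for r \<omega>
  proof -
    have f: "finite (\<eta> \<omega> \<inter> ball 0 (real r))" using fin[OF w, of r] by (simp add: S_def)
    have eq: "{x \<in> S r \<omega>. T \<omega> x} = \<eta> \<omega> \<inter> (ball 0 (real r) \<inter> A \<omega>)"
      by (auto simp: S_def A_def)
    show ?thesis
    proof (cases "S r \<omega> = {}")
      case True
      then show ?thesis by (simp add: K_def)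
    next
      case False
      then have "point_count (\<eta> \<omega>) (ball 0 (real r)) \<noteq> 0"
        using f by (auto simp: point_count_finite S_def)
      moreover have "point_count (\<eta> \<omega>) (ball 0 (real r)) \<noteq> top"
        using f by (simp add: point_count_finite)
      ultimately show ?thesis
        unfolding emK[OF w A_sets[OF w]] eq
        by (simp add: point_count_def[symmetric] ennreal_mult_divide_eq ennreal_times_divide
            mult.commute[of "point_count (\<eta> \<omega>) (ball 0 (real r))"])
    qed
  qed
  have meas_r: "(\<lambda>\<omega>. emeasure (count_space UNIV) {x \<in> S r \<omega>. T \<omega> x}) \<in> borel_measurable M" for r
    using emeasure_measurable_subprob_algebra2[OF SA K_meas[of r]] \<eta>
    by (subst measurable_cong[OF count]) (auto intro!: borel_measurable_times_ennreal random_config_count)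
  have "emeasure (count_space UNIV) {x \<in> \<eta> \<omega>. T \<omega> x} =
      (SUP r. emeasure (count_space UNIV) {x \<in> S r \<omega>. T \<omega> x})" for \<omega>
  proof -
    have "(\<Union>r. {x \<in> S r \<omega>. T \<omega> x}) = {x \<in> \<eta> \<omega>. T \<omega> x}"
      using reals_Archimedean2 by (auto simp: S_def)
    moreover have "incseq (\<lambda>r. {x \<in> S r \<omega>. T \<omega> x})"
      by (force simp: incseq_def S_def)
    ultimately show ?thesis
      using SUP_emeasure_incseq[of "\<lambda>r. {x \<in> S r \<omega>. T \<omega> x}" "count_space UNIV"] by simp
  qed
  then show ?thesis using meas_r by simp
qed

lemma random_config_card:
  fixes \<eta> :: "'w \<Rightarrow> 'a::euclidean_space set"
  assumes "random_config M \<eta>"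
    and "Measurable.pred (M \<Otimes>\<^sub>M borel) (\<lambda>p. T (fst p) (snd p))"
  shows "(\<lambda>\<omega>. card {x \<in> \<eta> \<omega>. T \<omega> x}) \<in> measurable M (count_space UNIV)"
proof -
  \<comment> \<open>For infinite \<open>A\<close> both sides are 0, since \<open>enn2real\<close>
    sends infinity to 0.\<close>
  have "card A = nat \<lfloor>enn2real (emeasure (count_space UNIV) A)\<rfloor>" for A :: "'a set"
    by (cases "finite A") (simp_all add: emeasure_count_space ennreal_of_nat_eq_real_of_nat)
  then show ?thesis
    using random_config_ecard[OF assms] by simp
qed

lemma random_config_exists:
  fixes \<eta> :: "'w \<Rightarrow> 'a::euclidean_space set"
  assumes "random_config M \<eta>"
    and "Measurable.pred (M \<Otimes>\<^sub>M borel) (\<lambda>p. T (fst p) (snd p))"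
  shows "{\<omega> \<in> space M. \<exists>x\<in>\<eta> \<omega>. T \<omega> x} \<in> sets M"
proof -
  have "{\<omega> \<in> space M. emeasure (count_space UNIV) {x \<in> \<eta> \<omega>. T \<omega> x} \<noteq> 0} \<in> sets M"
    using random_config_ecard[OF assms] by measurable
  moreover have "emeasure (count_space UNIV) A \<noteq> 0 \<longleftrightarrow> A \<noteq> {}" for A :: "'a set"
    by (simp add: emeasure_count_space_eq_0)
  ultimately show ?thesis by (auto simp: ex_in_conv[symmetric] Bex_def)
qed

text \<open>With balls replaced by comparisons of distances, the degree is a nested count of
  configuration points with a measurable property, the form that \<open>random_config_card\<close>
  handles.\<close>

lemma knn_degree_alt:
  assumes "y \<in> X"
  shows "knn_degree k X y = card {z \<in> X. y \<noteq> z \<and>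
     (card {x \<in> X. x \<noteq> y \<and> dist y x \<le> dist y z} \<le> k \<or> card {x \<in> X. x \<noteq> z \<and> dist z x \<le> dist z y} \<le> k)}"
proof -
  have "cball y (dist y z) \<inter> (X - {y}) = {x \<in> X. x \<noteq> y \<and> dist y x \<le> dist y z}" for y z :: 'a
    by auto
  then show ?thesis
    using assms by (auto simp: knn_degree_def knn_adjacent_def nearest_neighbours_def intro!: arg_cong[of _ _ card])
qed

text \<open>The innermost counts have two free points, the outer count has one.
  \<open>random_config_fst\<close> turns free points into coordinates of the sample space, and each
  level of counting removes one of them.\<close>

lemma pred_knn_degree:
  fixes \<eta> :: "'w \<Rightarrow> 'a::euclidean_space set"
  assumes \<eta>: "random_config M \<eta>"
  shows "Measurable.pred (M \<Otimes>\<^sub>M borel) (\<lambda>p. card {z \<in> \<eta> (fst p). snd p \<noteq> z \<and>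
     (card {x \<in> \<eta> (fst p). x \<noteq> snd p \<and> dist (snd p) x \<le> dist (snd p) z} \<le> k \<or>
      card {x \<in> \<eta> (fst p). x \<noteq> z \<and> dist z x \<le> dist z (snd p)} \<le> k)} = j)"
proof -
  let ?M2 = "M \<Otimes>\<^sub>M (borel :: 'a measure)"
  let ?M3 = "?M2 \<Otimes>\<^sub>M (borel :: 'a measure)"
  have \<eta>2: "random_config ?M2 (\<lambda>p. \<eta> (fst p))" by (rule random_config_fst[OF \<eta>])
  have \<eta>3: "random_config ?M3 (\<lambda>p. \<eta> (fst (fst p)))" by (rule random_config_fst[OF \<eta>2])
  have 1: "(\<lambda>p. card {x \<in> \<eta> (fst (fst p)). x \<noteq> snd (fst p) \<and> dist (snd (fst p)) x \<le> dist (snd (fst p)) (snd p)})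
      \<in> measurable ?M3 (count_space UNIV)"
    by (rule random_config_card[OF \<eta>3]) measurable
  have 2: "(\<lambda>p. card {x \<in> \<eta> (fst (fst p)). x \<noteq> snd p \<and> dist (snd p) x \<le> dist (snd p) (snd (fst p))})
      \<in> measurable ?M3 (count_space UNIV)"
    by (rule random_config_card[OF \<eta>3]) measurable
  have "(\<lambda>p. card {z \<in> \<eta> (fst p). snd p \<noteq> z \<and>
     (card {x \<in> \<eta> (fst p). x \<noteq> snd p \<and> dist (snd p) x \<le> dist (snd p) z} \<le> k \<or>
      card {x \<in> \<eta> (fst p). x \<noteq> z \<and> dist z x \<le> dist z (snd p)} \<le> k)}) \<in> measurable ?M2 (count_space UNIV)"
    by (rule random_config_card[OF \<eta>2]) (use 1 2 in measurable)
  then show ?thesis by measurable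
qed

lemma measurable_num_degree:
  fixes \<eta> :: "'w \<Rightarrow> 'a::euclidean_space set"
  assumes "random_config M \<eta>"
  shows "(\<lambda>\<omega>. num_degree k j (\<eta> \<omega>)) \<in> measurable M (count_space UNIV)"
proof -
  have "num_degree k j X = card {y \<in> X. card {z \<in> X. y \<noteq> z \<and>
     (card {x \<in> X. x \<noteq> y \<and> dist y x \<le> dist y z} \<le> k \<or>
      card {x \<in> X. x \<noteq> z \<and> dist z x \<le> dist z y} \<le> k)} = j}" for X :: "'a set"
    unfolding num_degree_def
    by (intro arg_cong[of _ _ card] Collect_cong conj_cong refl) (simp only: knn_degree_alt)
  then show ?thesis
    using random_config_card[OF assms pred_knn_degree[OF assms, of k j]] by simp
qed

lemma sets_degree_occurs:
  fixes \<eta> :: "'w \<Rightarrow> 'a::euclidean_space set"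
  assumes "random_config M \<eta>"
  shows "{\<omega> \<in> space M. \<exists>y\<in>\<eta> \<omega>. knn_degree k (\<eta> \<omega>) y = j} \<in> sets M"
proof -
  have "(\<exists>y\<in>X. knn_degree k X y = j) \<longleftrightarrow> (\<exists>y\<in>X. card {z \<in> X. y \<noteq> z \<and>
     (card {x \<in> X. x \<noteq> y \<and> dist y x \<le> dist y z} \<le> k \<or>
      card {x \<in> X. x \<noteq> z \<and> dist z x \<le> dist z y} \<le> k)} = j)" for X :: "'a set"
    by (intro bex_cong refl) (simp only: knn_degree_alt)
  then show ?thesis
    using random_config_exists[OF assms pred_knn_degree[OF assms, of k j]] by simp
qed

lemma sets_Collect_all_less:
  assumes "\<And>i::nat. i < m \<Longrightarrow> {x \<in> space M. Q i x} \<in> sets M"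
  shows "{x \<in> space M. \<forall>i<m. Q i x} \<in> sets M"
  using sets.sets_Collect_finite_All[of "{..<m}" M Q] assms by simp

section \<open>Independence over disjoint regions\<close>

text \<open>Finite families of constraints, rather than single ones, form a pi-system; it generates
  the information carried by the points in \<open>A\<close>, and independence has to be checked only
  on it.\<close>

definition count_events :: "'w measure \<Rightarrow> ('w \<Rightarrow> 'a::euclidean_space set) \<Rightarrow> 'a set \<Rightarrow> 'w set set" where
  "count_events P \<eta> A = {{\<omega> \<in> space P. \<forall>i<m. point_count (\<eta> \<omega>) (B i) \<in> C i} |(m::nat) B C.
     \<forall>i<m. B i \<in> sets borel \<and> B i \<subseteq> A \<and> C i \<in> sets borel}"

definition count_sigma :: "'w measure \<Rightarrow> ('w \<Rightarrow> 'a::euclidean_space set) \<Rightarrow> 'a set \<Rightarrow> 'w measure" where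
  "count_sigma P \<eta> A = sigma (space P) (count_events P \<eta> A)"

lemma count_events_Pow: "count_events P \<eta> A \<subseteq> Pow (space P)"
  by (auto simp: count_events_def)

lemma space_count_sigma [simp]: "space (count_sigma P \<eta> A) = space P"
  by (simp add: count_sigma_def space_measure_of[OF count_events_Pow])

lemma sets_count_sigma: "sets (count_sigma P \<eta> A) = sigma_sets (space P) (count_events P \<eta> A)"
  by (simp add: count_sigma_def sets_measure_of[OF count_events_Pow])

lemma count_events_mono: "A \<subseteq> A' \<Longrightarrow> count_events P \<eta> A \<subseteq> count_events P \<eta> A'"
  unfolding count_events_def by blast

lemma count_sigma_mono: "A \<subseteq> A' \<Longrightarrow> sets (count_sigma P \<eta> A) \<subseteq> sets (count_sigma P \<eta> A')"
  unfolding sets_count_sigma by (rule sigma_sets_mono'[OF count_events_mono])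

lemma count_events_sets:
  assumes "random_config P \<eta>"
  shows "count_events P \<eta> A \<subseteq> sets P"
proof
  fix E assume "E \<in> count_events P \<eta> A"
  then obtain m :: nat and B C where E: "E = {\<omega> \<in> space P. \<forall>i<m. point_count (\<eta> \<omega>) (B i) \<in> C i}"
    and BC: "\<And>i. i < m \<Longrightarrow> B i \<in> sets borel \<and> B i \<subseteq> A \<and> C i \<in> sets borel"
    unfolding count_events_def by blast
  have "{\<omega> \<in> space P. point_count (\<eta> \<omega>) (B i) \<in> C i} \<in> sets P" if "i < m" for i
    using measurable_sets[OF random_config_count[OF assms], of "B i" "C i"] BC[OF that]
    by (simp add: vimage_def Int_def conj_commute)
  then show "E \<in> sets P" unfolding E by (rule sets_Collect_all_less)
qed

lemma count_sigma_sets: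
  assumes "random_config P \<eta>"
  shows "sets (count_sigma P \<eta> A) \<subseteq> sets P"
  unfolding sets_count_sigma by (rule sets.sigma_sets_subset[OF count_events_sets[OF assms]])

lemma Int_stable_count_events: "Int_stable (count_events P \<eta> A)"
proof (rule Int_stableI)
  fix E E' assume "E \<in> count_events P \<eta> A" "E' \<in> count_events P \<eta> A"
  then obtain m m' :: nat and B B' C C' where
    E: "E = {\<omega> \<in> space P. \<forall>i<m. point_count (\<eta> \<omega>) (B i) \<in> C i}"
      "\<And>i. i < m \<Longrightarrow> B i \<in> sets borel \<and> B i \<subseteq> A \<and> C i \<in> sets borel" and
    E': "E' = {\<omega> \<in> space P. \<forall>i<m'. point_count (\<eta> \<omega>) (B' i) \<in> C' i}"
      "\<And>i. i < m' \<Longrightarrow> B' i \<in> sets borel \<and> B' i \<subseteq> A \<and> C' i \<in> sets borel"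
    unfolding count_events_def by blast
  define BB where "BB i = (if i < m then B i else B' (i - m))" for i
  define CC where "CC i = (if i < m then C i else C' (i - m))" for i
  have *: "(\<forall>i<m + m'. Q i) \<longleftrightarrow> (\<forall>i<m. Q i) \<and> (\<forall>i<m'. Q (m + i))" for Q
    by (metis add_less_cancel_left le_add_diff_inverse less_diff_conv2 not_less trans_less_add1 add.commute)
  have "E \<inter> E' = {\<omega> \<in> space P. \<forall>i<m + m'. point_count (\<eta> \<omega>) (BB i) \<in> CC i}"
    unfolding E(1) E'(1) * by (auto simp: BB_def CC_def)
  moreover have "\<forall>i<m + m'. BB i \<in> sets borel \<and> BB i \<subseteq> A \<and> CC i \<in> sets borel"
    unfolding * using E(2) E'(2) by (simp add: BB_def CC_def)
  ultimately show "E \<inter> E' \<in> count_events P \<eta> A"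
    unfolding count_events_def by blast
qed

lemma point_count_measurable_count_sigma:
  assumes "B \<in> sets borel" "B \<subseteq> A"
  shows "(\<lambda>\<omega>. point_count (\<eta> \<omega>) B) \<in> borel_measurable (count_sigma P \<eta> A)"
proof (rule measurableI)
  fix C :: "ennreal set" assume "C \<in> sets borel"
  then have "{\<omega> \<in> space P. \<forall>i<1::nat. point_count (\<eta> \<omega>) B \<in> C} \<in> count_events P \<eta> A"
    unfolding count_events_def using assms
    by (intro CollectI exI[of _ 1] exI[of _ "\<lambda>_. B"] exI[of _ "\<lambda>_. C"]) auto
  then show "(\<lambda>\<omega>. point_count (\<eta> \<omega>) B) -` C \<inter> space (count_sigma P \<eta> A) \<in> sets (count_sigma P \<eta> A)"
    by (auto simp: sets_count_sigma vimage_def Int_def conj_commute intro: sigma_sets.Basic)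
qed simp

text \<open>Every measurability result for \<open>random_config\<close> now applies over the smaller
  sigma-algebra: functionals of the points in \<open>A\<close> are measurable with respect to the
  counts inside \<open>A\<close>.\<close>

lemma random_config_restrict:
  assumes "random_config P \<eta>" "A \<in> sets borel"
  shows "random_config (count_sigma P \<eta> A) (\<lambda>\<omega>. \<eta> \<omega> \<inter> A)"
  unfolding random_config_def
proof (intro conjI ballI allI impI)
  fix \<omega> and B :: "'b set" assume "\<omega> \<in> space (count_sigma P \<eta> A)" "bounded B"
  then have "finite (\<eta> \<omega> \<inter> B)" using random_config_finite[OF assms(1)] by simp
  then show "finite (\<eta> \<omega> \<inter> A \<inter> B)" by (rule rev_finite_subset) auto
next
  fix B :: "'b set" assume B: "B \<in> sets borel"
  have "point_count (X \<inter> A) B = point_count X (A \<inter> B)" for X :: "'b set"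
    by (simp add: point_count_def Int_assoc)
  then show "(\<lambda>\<omega>. point_count (\<eta> \<omega> \<inter> A) B) \<in> borel_measurable (count_sigma P \<eta> A)"
    using point_count_measurable_count_sigma[of "A \<inter> B" A] assms B by auto
qed

lemma random_config_poisson: "poisson_process P \<Lambda> \<eta> \<Longrightarrow> random_config P \<eta>"
  by (simp add: poisson_process_def random_config_def)

text \<open>The atoms of the algebra generated by the sets in both events form one disjoint family; they
  are indexed by the binary code of the set of indices \<open>i\<close> with \<open>x \<in> B i\<close>.\<close>

lemma prob_count_events_Int:
  fixes \<eta> :: "'w \<Rightarrow> 'a::euclidean_space set"
  assumes pp: "poisson_process P \<Lambda> \<eta>" and disj: "A1 \<inter> A2 = {}"
    and "E1 \<in> count_events P \<eta> A1" "E2 \<in> count_events P \<eta> A2"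
  shows "measure P (E1 \<inter> E2) = measure P E1 * measure P E2"
proof -
  interpret prob_space P using pp by (simp add: poisson_process_def)
  from assms(3,4) obtain m1 m2 :: nat and B1 B2 C1 C2 where
    E1: "E1 = {\<omega> \<in> space P. \<forall>i<m1. point_count (\<eta> \<omega>) (B1 i) \<in> C1 i}"
      "\<And>i. i < m1 \<Longrightarrow> B1 i \<in> sets borel \<and> B1 i \<subseteq> A1 \<and> C1 i \<in> sets borel" and
    E2: "E2 = {\<omega> \<in> space P. \<forall>i<m2. point_count (\<eta> \<omega>) (B2 i) \<in> C2 i}"
      "\<And>i. i < m2 \<Longrightarrow> B2 i \<in> sets borel \<and> B2 i \<subseteq> A2 \<and> C2 i \<in> sets borel"
    unfolding count_events_def by blast
  define m where "m = m1 + m2"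
  define B where "B i = (if i < m1 then B1 i else if i < m then B2 (i - m1) else {})" for i
  define D where "D e = {x. \<forall>i. x \<in> B i \<longleftrightarrow> i \<in> set_decode e}" for e
  \<comment> \<open>As \<open>A1\<close> and \<open>A2\<close> are disjoint, a point of some
    \<open>B i\<close> has all its indices in one of the two ranges. The empty index set lies in
    both and is removed to keep \<open>K1\<close> and \<open>K2\<close> disjoint.\<close>
  define K1 where "K1 = set_encode ` (Pow {..<m1} - {{}})"
  define K2 where "K2 = set_encode ` (Pow {m1..<m} - {{}})"
  have B_low: "B i = B1 i" if "i < m1" for i using that by (simp add: B_def)
  have B_high: "B (m1 + i) = B2 i" if "i < m2" for i using that by (simp add: B_def m_def)
  have B_A1: "B i \<subseteq> A1" if "i < m1" for i using that E1(2) B_low by simp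
  have B_A2: "B i \<subseteq> A2" if "\<not> i < m1" for i
    using that E2(2)[of "i - m1"] by (auto simp: B_def m_def)
  have B_m: "i < m" if "x \<in> B i" for i x using that by (auto simp: B_def m_def split: if_splits)
  have B_sets [measurable]: "B i \<in> sets borel" for i
    using E1(2) E2(2) by (auto simp: B_def m_def)
  have D_sets: "D e \<in> sets borel" for e
  proof -
    have "{x \<in> space borel. \<forall>i. x \<in> B i \<longleftrightarrow> i \<in> set_decode e} \<in> sets borel" by measurable
    then show ?thesis by (simp add: D_def)
  qed
  have fK: "finite K1" "finite K2" by (auto simp: K1_def K2_def)
  have K12: "K1 \<inter> K2 = {}"
  proof -
    have "J = J'" if "set_encode J = set_encode J'" "J \<subseteq> {..<m1}" "J' \<subseteq> {m1..<m}" for J J'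
      using that set_encode_eq[of J J'] finite_subset[of J] finite_subset[of J'] by blast
    moreover have "J = {}" if "J \<subseteq> {..<m1}" "J \<subseteq> {m1..<m}" for J
    proof -
      have "{..<m1} \<inter> {m1..<m} = {}" by auto
      then show ?thesis using that by blast
    qed
    ultimately show ?thesis unfolding K1_def K2_def by blast
  qed
  have D_disj: "disjoint_family_on D I" for I
    unfolding disjoint_family_on_def
  proof (intro ballI impI)
    fix e e' :: nat assume "e \<noteq> e'"
    moreover have "e = e'" if "x \<in> D e" "x \<in> D e'" for x
    proof -
      have "set_decode e = set_decode e'" using that by (auto simp: D_def)
      then show ?thesis by (metis set_decode_inverse)
    qed
    ultimately show "D e \<inter> D e' = {}" by blast
  qed
  \<comment> \<open>Each given count is a sum of counts of atoms, so the two events depend on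
    disjoint groups of one independent family.\<close>
  have count_sum: "point_count X (B i) = (\<Sum>e\<in>{e \<in> K. i \<in> set_decode e}. point_count X (D e))"
    if K: "finite K" and cov: "\<And>x. x \<in> B i \<Longrightarrow> \<exists>e\<in>K. x \<in> D e" for i K and X :: "'a set"
  proof -
    let ?K = "{e \<in> K. i \<in> set_decode e}"
    have "B i = (\<Union>e\<in>?K. D e)"
      using cov by (auto simp: D_def)
    then have "X \<inter> B i = (\<Union>e\<in>?K. X \<inter> D e)" by auto
    moreover have "disjoint_family_on (\<lambda>e. X \<inter> D e) ?K"
      using D_disj[of ?K] by (auto simp: disjoint_family_on_def)
    ultimately show ?thesis
      unfolding point_count_def using K by (simp add: sum_emeasure)
  qed
  have code: "x \<in> D (set_encode {l. x \<in> B l})" for x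
  proof -
    have "finite {l. x \<in> B l}" by (rule finite_subset[of _ "{..<m}"]) (auto dest: B_m)
    then show ?thesis by (simp add: D_def)
  qed
  have cov1: "\<exists>e\<in>K1. x \<in> D e" if x: "x \<in> B i" and i: "i < m1" for x i
  proof -
    have "{l. x \<in> B l} \<subseteq> {..<m1}" using B_A1[OF i] B_A2 x disj by fastforce
    then have "set_encode {l. x \<in> B l} \<in> K1" unfolding K1_def using x by blast
    then show ?thesis using code by blast
  qed
  have cov2: "\<exists>e\<in>K2. x \<in> D e" if x: "x \<in> B i" and i: "\<not> i < m1" for x i
  proof -
    have "{l. x \<in> B l} \<subseteq> {m1..<m}"
      using B_A2[OF i] B_A1 x disj B_m[of x] by (fastforce simp: not_less[symmetric])
    then have "set_encode {l. x \<in> B l} \<in> K2" unfolding K2_def using x by blast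
    then show ?thesis using code by blast
  qed
  define S1 where "S1 = {f \<in> space (PiM K1 (\<lambda>_. borel)).
      \<forall>i<m1. (\<Sum>e\<in>{e \<in> K1. i \<in> set_decode e}. f e) \<in> C1 i}"
  define S2 where "S2 = {f \<in> space (PiM K2 (\<lambda>_. borel)).
      \<forall>i<m2. (\<Sum>e\<in>{e \<in> K2. m1 + i \<in> set_decode e}. f e) \<in> C2 i}"
  have sum_meas: "{f \<in> space (PiM K (\<lambda>_. borel)). (\<Sum>e\<in>L. f e) \<in> C} \<in> sets (PiM K (\<lambda>_. borel))"
    if "L \<subseteq> K" "C \<in> sets borel" for K L :: "nat set" and C :: "ennreal set"
  proof -
    have "(\<lambda>f. \<Sum>e\<in>L. f e) \<in> borel_measurable (PiM K (\<lambda>_. borel :: ennreal measure))"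
      using that(1) by (intro borel_measurable_sum measurable_component_singleton) auto
    from measurable_sets[OF this that(2)] show ?thesis
      by (simp add: vimage_def Int_def conj_commute)
  qed
  have S_sets: "S1 \<in> sets (PiM K1 (\<lambda>_. borel))" "S2 \<in> sets (PiM K2 (\<lambda>_. borel))"
    unfolding S1_def S2_def
    by (rule sets_Collect_all_less, rule sum_meas, use E1(2) E2(2) in blast, use E1(2) E2(2) in blast)+
  define Y1 where "Y1 \<omega> = restrict (\<lambda>e. point_count (\<eta> \<omega>) (D e)) K1" for \<omega>
  define Y2 where "Y2 \<omega> = restrict (\<lambda>e. point_count (\<eta> \<omega>) (D e)) K2" for \<omega>
  have "indep_vars (\<lambda>_. borel) (\<lambda>e \<omega>. point_count (\<eta> \<omega>) (D e)) (K1 \<union> K2)"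
  proof -
    have "\<forall>(B :: nat \<Rightarrow> 'a set) I. finite I \<and> disjoint_family_on B I \<and> (\<forall>i\<in>I. B i \<in> sets borel) \<longrightarrow>
        indep_vars (\<lambda>_. borel) (\<lambda>i \<omega>. point_count (\<eta> \<omega>) (B i)) I"
      using pp by (simp add: poisson_process_def)
    from this[rule_format, of "K1 \<union> K2" D] show ?thesis using fK D_disj D_sets by simp
  qed
  then have ind: "indep_var (PiM K1 (\<lambda>_. borel)) Y1 (PiM K2 (\<lambda>_. borel)) Y2"
    unfolding Y1_def Y2_def using K12 by (intro indep_var_restrict) auto
  have "(\<Sum>e\<in>{e \<in> K1. i \<in> set_decode e}. Y1 \<omega> e) = point_count (\<eta> \<omega>) (B1 i)" if "i < m1" for i \<omega>
  proof -
    have "point_count (\<eta> \<omega>) (B i) = (\<Sum>e\<in>{e \<in> K1. i \<in> set_decode e}. point_count (\<eta> \<omega>) (D e))"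
      by (rule count_sum[OF fK(1) cov1[OF _ that]]) auto
    then show ?thesis unfolding B_low[OF that] Y1_def by (auto intro: sum.cong)
  qed
  then have E1': "E1 = Y1 -` S1 \<inter> space P"
    unfolding E1(1) S1_def by (auto simp: space_PiM Y1_def)
  have "(\<Sum>e\<in>{e \<in> K2. m1 + i \<in> set_decode e}. Y2 \<omega> e) = point_count (\<eta> \<omega>) (B2 i)" if "i < m2" for i \<omega>
  proof -
    have "point_count (\<eta> \<omega>) (B (m1 + i)) = (\<Sum>e\<in>{e \<in> K2. m1 + i \<in> set_decode e}. point_count (\<eta> \<omega>) (D e))"
      by (rule count_sum[OF fK(2) cov2]) auto
    then show ?thesis unfolding B_high[OF that] Y2_def by (auto intro: sum.cong)
  qed
  then have E2': "E2 = Y2 -` S2 \<inter> space P"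
    unfolding E2(1) S2_def by (auto simp: space_PiM Y2_def)
  have "E1 \<inter> E2 = (\<lambda>\<omega>. (Y1 \<omega>, Y2 \<omega>)) -` (S1 \<times> S2) \<inter> space P"
    unfolding E1' E2' by auto
  then show ?thesis using indep_varD[OF ind S_sets] E1' E2' by simp
qed

lemma indep_count_sigma:
  fixes \<eta> :: "'w \<Rightarrow> 'a::euclidean_space set"
  assumes pp: "poisson_process P \<Lambda> \<eta>" and disj: "A1 \<inter> A2 = {}"
  shows "prob_space.indep_set P (sets (count_sigma P \<eta> A1)) (sets (count_sigma P \<eta> A2))"
proof -
  interpret prob_space P using pp by (simp add: poisson_process_def)
  show ?thesis
    unfolding sets_count_sigma
    using count_events_sets[OF random_config_poisson[OF pp]] prob_count_events_Int[OF pp disj]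
    by (intro indep_set_sigma_sets indep_setI Int_stable_count_events) auto
qed

lemma expectation_times_indicator:
  fixes \<eta> :: "'w \<Rightarrow> 'a::euclidean_space set" and Y :: "'w \<Rightarrow> real"
  assumes pp: "poisson_process P \<Lambda> \<eta>" and disj: "A1 \<inter> A2 = {}"
    and E: "E \<in> sets (count_sigma P \<eta> A1)" and Y: "Y \<in> borel_measurable (count_sigma P \<eta> A2)"
    and int: "integrable P Y"
  shows "(\<integral>\<omega>. Y \<omega> * indicator E \<omega> \<partial>P) = (\<integral>\<omega>. Y \<omega> \<partial>P) * measure P E"
proof -
  interpret prob_space P using pp by (simp add: poisson_process_def)
  note sub = count_sigma_sets[OF random_config_poisson[OF pp]]
  have EP: "E \<in> sets P" using E sub by blast
  have "sigma_sets (space P) {indicator E -` C \<inter> space P |C. C \<in> sets (borel :: real measure)}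
      \<subseteq> sets (count_sigma P \<eta> A1)"
  proof -
    have "indicator E \<in> borel_measurable (count_sigma P \<eta> A1)" using E by simp
    then have "{indicator E -` C \<inter> space P |C. C \<in> sets (borel :: real measure)} \<subseteq> sets (count_sigma P \<eta> A1)"
      using measurable_sets[of "indicator E" "count_sigma P \<eta> A1" "borel :: real measure"] by auto
    then show ?thesis using sets.sigma_sets_subset[of _ "count_sigma P \<eta> A1"] by simp
  qed
  moreover have "sigma_sets (space P) {Y -` C \<inter> space P |C. C \<in> sets borel} \<subseteq> sets (count_sigma P \<eta> A2)"
  proof -
    have "{Y -` C \<inter> space P |C. C \<in> sets borel} \<subseteq> sets (count_sigma P \<eta> A2)"
      using measurable_sets[OF Y] by auto
    then show ?thesis using sets.sigma_sets_subset[of _ "count_sigma P \<eta> A2"] by simp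
  qed
  ultimately have "indep_set (sigma_sets (space P) {indicator E -` C \<inter> space P |C. C \<in> sets (borel :: real measure)})
      (sigma_sets (space P) {Y -` C \<inter> space P |C. C \<in> sets borel})"
    using indep_count_sigma[OF pp disj] unfolding indep_sets2_eq by blast
  moreover have "indicator E \<in> borel_measurable P" "Y \<in> borel_measurable P"
    using EP int by auto
  ultimately have ind: "indep_var borel (indicator E :: 'w \<Rightarrow> real) borel Y"
    unfolding indep_var_eq by blast
  have "integrable P (indicator E :: 'w \<Rightarrow> real)"
    using EP by (intro integrable_real_indicator) (simp_all add: emeasure_eq_measure)
  from indep_var_lebesgue_integral[OF ind this int]
  show ?thesis using EP by (simp add: mult.commute)
qed

section \<open>Rescaling and the probability of a pattern\<close>

definition rescale :: "'a::real_vector \<Rightarrow> real \<Rightarrow> 'a \<Rightarrow> 'a" where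
  "rescale x h y = (1 / h) *\<^sub>R (y - x)"

lemma dist_rescale: "h > 0 \<Longrightarrow> dist (rescale x h y) (rescale x h z) = (1 / h) * dist y (z::'a::real_normed_vector)"
  by (simp add: rescale_def dist_norm flip: scaleR_diff_right)

lemma inj_rescale: "h > 0 \<Longrightarrow> inj (rescale x h)"
  by (auto simp: inj_def rescale_def)

lemma rescale_measurable [measurable]:
  "rescale x h \<in> borel_measurable (borel :: 'a::euclidean_space measure)"
  unfolding rescale_def by measurable

lemma rescale_image_Int: "rescale x h ` X \<inter> B = rescale x h ` (X \<inter> rescale x h -` B)"
  by auto

lemma rescale_vimage_ball:
  "h > 0 \<Longrightarrow> rescale x h -` ball 0 r = ball (x::'a::real_normed_vector) (h * r)"
proof -
  assume h: "h > 0"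
  have "norm (rescale x h y) < r \<longleftrightarrow> norm (y - x) < h * r" for y
    using h by (simp add: rescale_def pos_divide_less_eq mult.commute)
  then show ?thesis by (auto simp: dist_norm norm_minus_commute)
qed

lemma emeasure_rescale_vimage:
  fixes x :: "'a::euclidean_space"
  assumes h: "h > 0" and B: "B \<in> sets borel"
  shows "emeasure lborel (rescale x h -` B) = ennreal (h ^ DIM('a)) * emeasure lborel B"
proof -
  have r: "rescale x h = (\<lambda>y. - (1 / h) *\<^sub>R x + (1 / h) *\<^sub>R y)"
    by (auto simp: rescale_def algebra_simps)
  have meas: "rescale x h \<in> measurable lborel borel" by simp
  have "emeasure lborel B = emeasure (density (distr lborel borel (rescale x h)) (\<lambda>_. \<bar>1 / h\<bar> ^ DIM('a))) B"
    using lborel_affine[of "1 / h" "- (1 / h) *\<^sub>R x"] h unfolding r by simp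
  also have "\<dots> = ennreal ((1 / h) ^ DIM('a)) * emeasure lborel (rescale x h -` B)"
    using B h meas by (simp add: emeasure_density nn_integral_cmult_indicator emeasure_distr)
  finally have "ennreal (h ^ DIM('a)) * emeasure lborel B =
      ennreal (h ^ DIM('a) * (1 / h) ^ DIM('a)) * emeasure lborel (rescale x h -` B)"
    using h by (simp add: ennreal_mult mult.assoc)
  then show ?thesis using h by (simp flip: power_mult_distrib)
qed

lemma emeasure_restricted_lebesgue:
  fixes W :: "'a::euclidean_space set"
  assumes "W \<in> sets borel" "B \<in> sets borel"
  shows "emeasure (restricted_lebesgue s W) B = ennreal s * emeasure lborel (W \<inter> B)"
  using assms by (simp add: restricted_lebesgue_def emeasure_restricted)

lemma card_rescale_Int:
  "h > 0 \<Longrightarrow> card (rescale x h ` X \<inter> B) = card (X \<inter> rescale x h -` (B::'a::real_normed_vector set))"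
  unfolding rescale_image_Int by (intro card_image inj_on_subset[OF inj_rescale]) auto

text \<open>The probability under unit intensity: a Poisson weight for each cell and a void
  probability for the rest of \<open>R\<close>.\<close>

definition pattern_prob :: "nat \<Rightarrow> (nat \<Rightarrow> 'a::euclidean_space) \<Rightarrow> real \<Rightarrow> (nat \<Rightarrow> nat) \<Rightarrow> 'a set \<Rightarrow> real" where
  "pattern_prob m c \<delta> n R =
    (\<Prod>i<m. exp (- measure lborel (ball (c i) \<delta>)) * measure lborel (ball (c i) \<delta>) ^ n i / fact (n i)) *
    exp (- measure lborel (R - (\<Union>i<m. ball (c i) \<delta>)))"

lemma pattern_prob_pos:
  assumes "\<delta> > 0" shows "pattern_prob m c \<delta> n R > 0"
  unfolding pattern_prob_def using assms
  by (intro mult_pos_pos prod_pos divide_pos_pos zero_less_power) (auto simp: content_ball_pos)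

text \<open>Under \<open>s * h ^ DIM('a) = 1\<close> the preimage of a set in \<open>R\<close> has
  intensity mass equal to the volume of that set, as it lies in \<open>W\<close>. The probability
  therefore depends neither on \<open>s\<close> nor on the position \<open>x\<close>.\<close>

lemma prob_matches:
  fixes \<eta> :: "'w \<Rightarrow> 'a::euclidean_space set"
  assumes pp: "poisson_process P (restricted_lebesgue s W) \<eta>" and W: "W \<in> sets borel"
    and cells: "cells_in m c \<delta> R" and R: "bounded R" "R \<in> sets borel"
    and h: "h > 0" "s * h ^ DIM('a) = 1" and RW: "rescale x h -` R \<subseteq> W"
  shows "{\<omega> \<in> space P. matches m c \<delta> n R (rescale x h ` \<eta> \<omega>)} \<in> sets (count_sigma P \<eta> (rescale x h -` R))" (is "?E \<in> _")
    and "measure P {\<omega> \<in> space P. matches m c \<delta> n R (rescale x h ` \<eta> \<omega>)} = pattern_prob m c \<delta> n R"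
proof -
  interpret prob_space P using pp by (simp add: poisson_process_def)
  \<comment> \<open>Index \<open>m\<close> stands for the remainder of \<open>R\<close>, with
    prescribed count 0; the event thus constrains \<open>Suc m\<close> disjoint sets.\<close>
  define cell where "cell i = (if i < m then ball (c i) \<delta> else R - (\<Union>i<m. ball (c i) \<delta>))" for i
  define B where "B i = rescale x h -` cell i" for i
  define N where "N i = (if i < m then n i else 0)" for i
  have cell_R: "cell i \<subseteq> R" for i using cells by (auto simp: cell_def cells_in_def)
  have cell_sets: "cell i \<in> sets borel" for i
    unfolding cell_def using R(2) by (auto intro!: sets.Diff sets.finite_UN)
  have B_sets: "B i \<in> sets borel" for i
    using measurable_sets[OF rescale_measurable cell_sets] by (simp add: B_def)
  have B_W: "B i \<subseteq> W" for i using RW cell_R[of i] by (auto simp: B_def)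
  have bdd: "bounded (rescale x h -` R)"
  proof -
    obtain r where "R \<subseteq> ball 0 r" using R(1) bounded_subset_ballD[of R 0] by blast
    then have "rescale x h -` R \<subseteq> ball x (h * r)" using rescale_vimage_ball[OF h(1), of x r] by blast
    then show ?thesis using bounded_subset bounded_ball by blast
  qed
  have s: "s > 0" using h by (metis zero_less_mult_pos2 zero_less_one zero_less_power)
  have fin: "finite (\<eta> \<omega> \<inter> rescale x h -` C)" if "\<omega> \<in> space P" "C \<subseteq> R" for \<omega> C
  proof -
    have "finite (\<eta> \<omega> \<inter> rescale x h -` R)"
      using random_config_finite[OF random_config_poisson[OF pp] that(1) bdd] .
    then show ?thesis by (rule rev_finite_subset) (use that in auto)
  qed
  have iff: "matches m c \<delta> n R (rescale x h ` \<eta> \<omega>) \<longleftrightarrow> (\<forall>i<Suc m. point_count (\<eta> \<omega>) (B i) = of_nat (N i))"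
    if w: "\<omega> \<in> space P" for \<omega>
  proof -
    have pc: "point_count (\<eta> \<omega>) (B i) = of_nat (N i) \<longleftrightarrow> card (rescale x h ` \<eta> \<omega> \<inter> cell i) = N i" for i
      unfolding card_rescale_Int[OF h(1)] B_def point_count_finite[OF fin[OF w cell_R]] by simp
    have f0: "finite (rescale x h ` \<eta> \<omega> \<inter> cell m)"
      unfolding rescale_image_Int by (intro finite_imageI fin[OF w cell_R])
    have "rescale x h ` \<eta> \<omega> \<inter> R \<subseteq> (\<Union>i<m. ball (c i) \<delta>) \<longleftrightarrow> rescale x h ` \<eta> \<omega> \<inter> cell m = {}"
      by (auto simp: cell_def)
    also have "\<dots> \<longleftrightarrow> card (rescale x h ` \<eta> \<omega> \<inter> cell m) = N m"
      using f0 by (simp add: N_def)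
    finally show ?thesis
      unfolding matches_def pc less_Suc_eq by (auto simp: cell_def N_def)
  qed
  have E_eq: "?E = {\<omega> \<in> space P. \<forall>i<Suc m. point_count (\<eta> \<omega>) (B i) \<in> {of_nat (N i)}}"
    using iff by auto
  have "?E \<in> count_events P \<eta> (rescale x h -` R)"
    unfolding E_eq count_events_def using B_sets cell_R
    by (intro CollectI exI[of _ "Suc m"] exI[of _ B] exI[of _ "\<lambda>i. {of_nat (N i)}"]) (auto simp: B_def)
  then show "?E \<in> sets (count_sigma P \<eta> (rescale x h -` R))"
    unfolding sets_count_sigma by (rule sigma_sets.Basic)
  have vol: "emeasure (restricted_lebesgue s W) (B i) = emeasure lborel (cell i)" for i
  proof -
    have "emeasure (restricted_lebesgue s W) (B i) = ennreal s * (ennreal (h ^ DIM('a)) * emeasure lborel (cell i))"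
      unfolding emeasure_restricted_lebesgue[OF W B_sets] Int_absorb1[OF B_W]
      unfolding B_def by (simp add: emeasure_rescale_vimage[OF h(1) cell_sets])
    also have "\<dots> = ennreal (s * h ^ DIM('a)) * emeasure lborel (cell i)"
      using s h by (subst ennreal_mult) (auto simp: mult.assoc)
    finally show ?thesis using h by simp
  qed
  have finvol: "emeasure lborel (cell i) < \<infinity>" for i
    using emeasure_bounded_finite[OF bounded_subset[OF R(1) cell_R]] by simp
  have disj: "disjoint_family_on B {..<Suc m}"
  proof -
    have "cell i \<inter> cell l = {}" if "i < Suc m" "l < Suc m" "i \<noteq> l" for i l
      using that cells unfolding cell_def cells_in_def less_Suc_eq by (cases "i < m"; cases "l < m") auto
    then show ?thesis unfolding disjoint_family_on_def B_def by blast
  qed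
  have "\<forall>(B :: nat \<Rightarrow> 'a set) I. finite I \<and> disjoint_family_on B I \<and> (\<forall>i\<in>I. B i \<in> sets borel) \<longrightarrow>
      indep_vars (\<lambda>_. borel) (\<lambda>i \<omega>. point_count (\<eta> \<omega>) (B i)) I"
    using pp by (simp add: poisson_process_def)
  from this[rule_format, of "{..<Suc m}" B]
  have ind: "indep_vars (\<lambda>_. borel) (\<lambda>i \<omega>. point_count (\<eta> \<omega>) (B i)) {..<Suc m}"
    using disj B_sets by simp
  have "?E = (\<Inter>i\<in>{..<Suc m}. (\<lambda>\<omega>. point_count (\<eta> \<omega>) (B i)) -` {of_nat (N i)} \<inter> space P)"
    unfolding E_eq by auto
  then have "prob ?E = prob (\<Inter>i\<in>{..<Suc m}. (\<lambda>\<omega>. point_count (\<eta> \<omega>) (B i)) -` {of_nat (N i)} \<inter> space P)"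
    by (rule arg_cong)
  also have "\<dots> = (\<Prod>i<Suc m. prob ((\<lambda>\<omega>. point_count (\<eta> \<omega>) (B i)) -` {of_nat (N i)} \<inter> space P))"
    by (rule indep_varsD_finite[OF ind]) auto
  also have "\<dots> = (\<Prod>i<Suc m. exp (- measure lborel (cell i)) * measure lborel (cell i) ^ N i / fact (N i))"
  proof (intro prod.cong refl)
    fix i
    have "(\<lambda>\<omega>. point_count (\<eta> \<omega>) (B i)) -` {of_nat (N i)} \<inter> space P = {\<omega> \<in> space P. point_count (\<eta> \<omega>) (B i) = of_nat (N i)}"
      by auto
    moreover have "emeasure (restricted_lebesgue s W) (B i) < \<infinity>" using vol finvol by simp
    moreover have "measure (restricted_lebesgue s W) (B i) = measure lborel (cell i)"
      using vol by (simp add: measure_def)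
    ultimately show "prob ((\<lambda>\<omega>. point_count (\<eta> \<omega>) (B i)) -` {of_nat (N i)} \<inter> space P) =
        exp (- measure lborel (cell i)) * measure lborel (cell i) ^ N i / fact (N i)"
      using pp B_sets[of i] unfolding poisson_process_def by simp
  qed
  also have "\<dots> = pattern_prob m c \<delta> n R"
    by (simp add: pattern_prob_def N_def cell_def)
  finally show "prob ?E = pattern_prob m c \<delta> n R" .
qed

section \<open>Second moments and the abstract variance bound\<close>

lemma integrable_poisson_count_square:
  fixes N :: "'w \<Rightarrow> nat"
  assumes "prob_space P" and N: "N \<in> measurable P (count_space UNIV)" and l: "l \<ge> 0"
    and pois: "\<And>m. measure P {\<omega> \<in> space P. N \<omega> = m} = exp (- l) * l ^ m / fact m"
  shows "integrable P (\<lambda>\<omega>. (real (N \<omega>))\<^sup>2)"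
proof (rule integrableI_bounded)
  interpret prob_space P by fact
  note [measurable] = N
  show "(\<lambda>\<omega>. (real (N \<omega>))\<^sup>2) \<in> borel_measurable P" by measurable
  have "(\<integral>\<^sup>+\<omega>. ennreal (norm ((real (N \<omega>))\<^sup>2)) \<partial>P) =
      (\<integral>\<^sup>+\<omega>. (\<Sum>m. ennreal ((real m)\<^sup>2) * indicator {\<omega> \<in> space P. N \<omega> = m} \<omega>) \<partial>P)"
  proof (intro nn_integral_cong)
    fix \<omega> assume w: "\<omega> \<in> space P"
    have "(\<Sum>m. ennreal ((real m)\<^sup>2) * indicator {\<omega> \<in> space P. N \<omega> = m} \<omega>) =
        (\<Sum>m\<in>{N \<omega>}. ennreal ((real m)\<^sup>2) * indicator {\<omega> \<in> space P. N \<omega> = m} \<omega>)"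
      by (intro suminf_finite) auto
    then show "ennreal (norm ((real (N \<omega>))\<^sup>2)) = (\<Sum>m. ennreal ((real m)\<^sup>2) * indicator {\<omega> \<in> space P. N \<omega> = m} \<omega>)"
      using w by simp
  qed
  also have "\<dots> = (\<Sum>m. \<integral>\<^sup>+\<omega>. ennreal ((real m)\<^sup>2) * indicator {\<omega> \<in> space P. N \<omega> = m} \<omega> \<partial>P)"
    by (intro nn_integral_suminf) measurable
  also have "\<dots> = (\<Sum>m. ennreal ((real m)\<^sup>2 * (exp (- l) * l ^ m / fact m)))"
    using l by (simp add: nn_integral_cmult_indicator emeasure_eq_measure pois flip: ennreal_mult')
  also have "\<dots> < \<infinity>"
  proof -
    \<comment> \<open>From m < 2^m follows m^2 <= 4^m, so the exponential series at
      \<open>4 * l\<close> dominates.\<close>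
    have "summable (\<lambda>m. (4 * l) ^ m /\<^sub>R fact m)" by (rule summable_exp_generic)
    then have "summable (\<lambda>m. (real m)\<^sup>2 * (exp (- l) * l ^ m / fact m))"
    proof (rule summable_comparison_test')
      fix m :: nat
      have "(real m)\<^sup>2 \<le> (2 ^ m)\<^sup>2"
        using of_nat_less_two_power[of m, where 'a = real] by (intro power_mono) auto
      then have m4: "(real m)\<^sup>2 \<le> 4 ^ m" by (simp add: power2_eq_square flip: power_mult_distrib)
      have "(real m)\<^sup>2 * (exp (- l) * l ^ m / fact m) \<le> 4 ^ m * (1 * l ^ m / fact m)"
        using l m4 by (intro mult_mono divide_right_mono mult_right_mono) auto
      then show "norm ((real m)\<^sup>2 * (exp (- l) * l ^ m / fact m)) \<le> (4 * l) ^ m /\<^sub>R fact m"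
        using l by (simp add: power_mult_distrib divide_inverse mult_ac)
    qed
    then show ?thesis
      using l by (simp add: less_top ennreal_suminf_neq_top)
  qed
  finally show "(\<integral>\<^sup>+\<omega>. ennreal (norm ((real (N \<omega>))\<^sup>2)) \<partial>P) < \<infinity>" .
qed

text \<open>Expand \<open>0 \<le> E (F - E F - \<kappa> G)\<^sup>2\<close> for \<open>G = \<Sum>v. g v\<close>.\<close>

lemma (in prob_space) variance_ge_of_uncorrelated:
  fixes F :: "'a \<Rightarrow> real" and g :: "'v \<Rightarrow> 'a \<Rightarrow> real"
  assumes V: "finite V" and F: "integrable M F" "integrable M (\<lambda>\<omega>. (F \<omega>)\<^sup>2)"
    and g: "\<And>v. v \<in> V \<Longrightarrow> g v \<in> borel_measurable M" "\<And>v \<omega>. v \<in> V \<Longrightarrow> \<bar>g v \<omega>\<bar> \<le> 1"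
    and mean: "\<And>v. v \<in> V \<Longrightarrow> expectation (g v) = 0"
    and corr: "\<And>v. v \<in> V \<Longrightarrow> expectation (\<lambda>\<omega>. F \<omega> * g v \<omega>) = \<kappa>"
    and uncorr: "\<And>v w. v \<in> V \<Longrightarrow> w \<in> V \<Longrightarrow> v \<noteq> w \<Longrightarrow> expectation (\<lambda>\<omega>. g v \<omega> * g w \<omega>) = 0"
  shows "real (card V) * \<kappa>\<^sup>2 \<le> variance F"
proof -
  let ?\<mu> = "expectation F"
  define G where "G \<omega> = (\<Sum>v\<in>V. g v \<omega>)" for \<omega>
  have int_g: "integrable M (g v)" if "v \<in> V" for v
    using g[OF that] by (intro integrable_const_bound[of _ 1]) auto
  have int_Fg: "integrable M (\<lambda>\<omega>. F \<omega> * g v \<omega>)" if "v \<in> V" for v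
  proof (rule Bochner_Integration.integrable_bound[OF F(1)])
    show "(\<lambda>\<omega>. F \<omega> * g v \<omega>) \<in> borel_measurable M" using F(1) g(1)[OF that] by auto
    show "AE \<omega> in M. norm (F \<omega> * g v \<omega>) \<le> norm (F \<omega>)"
      using g(2)[OF that] by (intro AE_I2) (simp add: abs_mult mult_left_le)
  qed
  have int_gg: "integrable M (\<lambda>\<omega>. g v \<omega> * g w \<omega>)" if "v \<in> V" "w \<in> V" for v w
  proof (rule integrable_const_bound[of _ 1])
    show "AE \<omega> in M. norm (g v \<omega> * g w \<omega>) \<le> 1"
      using g(2)[OF that(1)] g(2)[OF that(2)] by (intro AE_I2) (simp add: abs_mult mult_le_one)
  qed (use g(1) that in auto)
  have int_G: "integrable M G" unfolding G_def using int_g by auto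
  have FG: "(\<lambda>\<omega>. F \<omega> * G \<omega>) = (\<lambda>\<omega>. \<Sum>v\<in>V. F \<omega> * g v \<omega>)" by (simp add: G_def sum_distrib_left)
  have GG: "(\<lambda>\<omega>. (G \<omega>)\<^sup>2) = (\<lambda>\<omega>. \<Sum>v\<in>V. \<Sum>w\<in>V. g v \<omega> * g w \<omega>)"
    by (simp add: G_def power2_eq_square sum_product)
  have int_FG: "integrable M (\<lambda>\<omega>. F \<omega> * G \<omega>)" unfolding FG using int_Fg by auto
  have int_GG: "integrable M (\<lambda>\<omega>. (G \<omega>)\<^sup>2)" unfolding GG using int_gg by auto
  have EG: "expectation G = 0" unfolding G_def using int_g mean by simp
  have EFG: "expectation (\<lambda>\<omega>. F \<omega> * G \<omega>) = real (card V) * \<kappa>"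
    unfolding FG using int_Fg corr by simp
  \<comment> \<open>Terms off the diagonal vanish, and those on it are at most 1 because the
    \<open>g v\<close> are bounded by 1.\<close>
  have "expectation (\<lambda>\<omega>. (G \<omega>)\<^sup>2) = (\<Sum>v\<in>V. \<Sum>w\<in>V. expectation (\<lambda>\<omega>. g v \<omega> * g w \<omega>))"
    unfolding GG using int_gg by simp
  also have "\<dots> \<le> (\<Sum>v\<in>V. \<Sum>w\<in>V. if w = v then 1 else 0)"
  proof (intro sum_mono)
    fix v w assume vw: "v \<in> V" "w \<in> V"
    show "expectation (\<lambda>\<omega>. g v \<omega> * g w \<omega>) \<le> (if w = v then 1 else 0)"
    proof (cases "w = v")
      case True
      have "expectation (\<lambda>\<omega>. g v \<omega> * g w \<omega>) \<le> expectation (\<lambda>_. 1)"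
      proof (rule integral_mono)
        fix \<omega>
        have "\<bar>g v \<omega> * g w \<omega>\<bar> \<le> 1" using g(2) vw by (auto simp: abs_mult intro: mult_le_one)
        then show "g v \<omega> * g w \<omega> \<le> 1" by simp
      qed (use int_gg vw in auto)
      then show ?thesis using True by (simp add: prob_space)
    next
      case False
      then show ?thesis using uncorr[OF vw] by auto
    qed
  qed
  also have "\<dots> = real (card V)" using V by simp
  finally have EGG: "expectation (\<lambda>\<omega>. (G \<omega>)\<^sup>2) \<le> real (card V)" .
  have sq: "(F \<omega> - ?\<mu> - \<kappa> * G \<omega>)\<^sup>2 =
      (F \<omega> - ?\<mu>)\<^sup>2 - 2 * \<kappa> * (F \<omega> * G \<omega>) + 2 * \<kappa> * ?\<mu> * G \<omega> + \<kappa>\<^sup>2 * (G \<omega>)\<^sup>2" for \<omega>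
    by (simp add: power2_eq_square algebra_simps)
  have int_V: "integrable M (\<lambda>\<omega>. (F \<omega> - ?\<mu>)\<^sup>2)"
    unfolding power2_diff using F by (auto intro!: Bochner_Integration.integrable_add Bochner_Integration.integrable_diff)
  have "0 \<le> expectation (\<lambda>\<omega>. (F \<omega> - ?\<mu> - \<kappa> * G \<omega>)\<^sup>2)" by simp
  also have "\<dots> = variance F - 2 * \<kappa> * expectation (\<lambda>\<omega>. F \<omega> * G \<omega>) + 2 * \<kappa> * ?\<mu> * expectation G
      + \<kappa>\<^sup>2 * expectation (\<lambda>\<omega>. (G \<omega>)\<^sup>2)"
    unfolding sq using int_V int_FG int_G int_GG by simp
  also have "\<dots> \<le> variance F - 2 * \<kappa> * (real (card V) * \<kappa>) + \<kappa>\<^sup>2 * real (card V)"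
    unfolding EFG EG using mult_left_mono[OF EGG, of "\<kappa>\<^sup>2"] by simp
  finally show ?thesis by (simp add: power2_eq_square algebra_simps)
qed

section \<open>Packing of balls\<close>

text \<open>The centres form a cubic grid of mesh \<open>24 * h\<close>, twice the radius of the
  balls. With at most 2 a / h points per axis it extends over at most 48 a in each coordinate, hence
  over 48 a d in norm by the l1 bound; the remaining 48 a of \<rho> leave room for the radius
  \<open>12 * h\<close>.\<close>

lemma lattice_packing:
  fixes w0 :: "real ^ 'd"
  assumes \<rho>: "\<rho> > 0"
  defines "a \<equiv> \<rho> / (48 * (real CARD('d) + 1))"
  assumes h: "0 < h" "h \<le> a"
  shows "\<exists>V. finite V \<and> (a / h) ^ CARD('d) \<le> real (card V) \<and>
    (\<forall>v\<in>V. ball v (h * 12) \<subseteq> ball w0 \<rho>) \<and> (\<forall>v\<in>V. \<forall>w\<in>V. v \<noteq> w \<longrightarrow> 24 * h \<le> dist v w)"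
proof -
  let ?d = "real CARD('d)"
  define m where "m = nat \<lfloor>2 * a / h\<rfloor>"
  define pt where "pt f = w0 + (\<chi> i. 24 * h * real (f i))" for f :: "'d \<Rightarrow> nat"
  define S where "S = (UNIV :: 'd set) \<rightarrow>\<^sub>E {..<m}"
  \<comment> \<open>Rounding down therefore loses at most half: m >= 2 a / h - 1 >= a / h.\<close>
  have "2 * a / h \<ge> 2" using h by (simp add: field_simps)
  then have m: "real m \<le> 2 * a / h" "2 * a / h - 1 \<le> real m"
    unfolding m_def by linarith+
  have "a / h \<ge> 1" using h by simp
  then have am: "a / h \<le> real m" using m(2) by simp
  have apart: "24 * h \<le> dist (pt f) (pt g)" if fg: "f \<noteq> g" for f g
  proof -
    obtain i where i: "f i \<noteq> g i" using fg by auto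
    have "24 * h * 1 \<le> 24 * h * \<bar>real (f i) - real (g i)\<bar>"
      using i h by (intro mult_left_mono) auto
    also have "\<dots> = \<bar>(pt f - pt g) $ i\<bar>" using h by (simp add: pt_def abs_mult flip: right_diff_distrib)
    also have "\<dots> \<le> dist (pt f) (pt g)" unfolding dist_norm by (rule component_le_norm_cart)
    finally show ?thesis by simp
  qed
  have "inj_on pt S"
  proof (rule inj_onI, rule ccontr)
    fix f g assume "pt f = pt g" "f \<noteq> g"
    then show False using apart[of f g] h by simp
  qed
  then have card: "card (pt ` S) = m ^ CARD('d)"
    by (simp add: card_image S_def card_PiE)
  have "ball (pt f) (h * 12) \<subseteq> ball w0 \<rho>" if f: "f \<in> S" for f
  proof
    fix y assume y: "y \<in> ball (pt f) (h * 12)"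
    have "dist w0 (pt f) = norm (\<chi> i. 24 * h * real (f i) :: real ^ 'd)"
      by (simp add: pt_def dist_norm)
    also have "\<dots> \<le> (\<Sum>i\<in>UNIV. \<bar>(\<chi> i. 24 * h * real (f i) :: real ^ 'd) $ i\<bar>)" by (rule norm_le_l1_cart)
    also have "\<dots> \<le> (\<Sum>i\<in>(UNIV :: 'd set). 24 * h * real m)"
    proof (intro sum_mono)
      fix i
      have "f i < m" using f by (auto simp: S_def)
      then show "\<bar>(\<chi> i. 24 * h * real (f i) :: real ^ 'd) $ i\<bar> \<le> 24 * h * real m"
        using h by (auto intro!: mult_left_mono)
    qed
    also have "\<dots> = ?d * 24 * (h * real m)" by simp
    also have "\<dots> \<le> ?d * 24 * (2 * a)"
      using m(1) h by (intro mult_left_mono) (auto simp: field_simps)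
    finally have "dist w0 y < ?d * 48 * a + 12 * h"
      using y dist_triangle[of w0 y "pt f"] by simp
    also have "\<dots> \<le> (?d + 1) * 48 * a" using h by (simp add: algebra_simps)
    also have "\<dots> = \<rho>"
    proof -
      have "e * 48 * (\<rho> / (48 * e)) = \<rho>" if "e > 0" for e using that by simp
      from this[of "?d + 1"] show ?thesis unfolding a_def by (simp only: of_nat_0_less_iff add_pos_pos zero_less_card_finite zero_less_one)
    qed
    finally show "y \<in> ball w0 \<rho>" by simp
  qed
  moreover have "finite (pt ` S)" by (simp add: S_def finite_PiE)
  moreover have "(a / h) ^ CARD('d) \<le> real (card (pt ` S))"
    unfolding card using am \<open>a / h \<ge> 1\<close> by (simp add: power_mono)
  moreover have "24 * h \<le> dist v w" if "v \<in> pt ` S" "w \<in> pt ` S" "v \<noteq> w" for v w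
  proof -
    obtain f g where "v = pt f" "w = pt g" using \<open>v \<in> pt ` S\<close> \<open>w \<in> pt ` S\<close> by (elim imageE)
    then show ?thesis using apart[of f g] \<open>v \<noteq> w\<close> by auto
  qed
  ultimately show ?thesis by (intro exI[of _ "pt ` S"]) blast
qed

section \<open>Almost sure finiteness and the maximal degree\<close>

lemma poisson_count_prob:
  assumes "poisson_process P \<Lambda> \<eta>" "B \<in> sets borel" "emeasure \<Lambda> B < \<infinity>"
  shows "measure P {\<omega> \<in> space P. point_count (\<eta> \<omega>) B = of_nat m} =
    exp (- measure \<Lambda> B) * measure \<Lambda> B ^ m / fact m"
  using assms by (simp add: poisson_process_def)

text \<open>The definition permits points outside \<open>W\<close>, but their number is Poisson with
  mean 0; local finiteness and compactness take care of those inside.\<close>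

lemma poisson_AE_finite:
  fixes \<eta> :: "'w \<Rightarrow> 'a::euclidean_space set"
  assumes pp: "poisson_process P (restricted_lebesgue s W) \<eta>" and W: "compact W"
  shows "AE \<omega> in P. \<eta> \<omega> \<subseteq> W \<and> finite (\<eta> \<omega>)"
proof -
  interpret prob_space P using pp by (simp add: poisson_process_def)
  have WB: "W \<in> sets borel" "- W \<in> sets borel" 
    using borel_compact[OF W] borel_comp by auto
  have 0: "emeasure (restricted_lebesgue s W) (- W) = 0"
    by (simp add: emeasure_restricted_lebesgue WB)
  then have "measure (restricted_lebesgue s W) (- W) = 0" by (simp add: measure_def)
  moreover have "emeasure (restricted_lebesgue s W) (- W) < \<infinity>" using 0 by simp
  ultimately have "prob {\<omega> \<in> space P. point_count (\<eta> \<omega>) (- W) = of_nat 0} = 1"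
    using poisson_count_prob[OF pp WB(2), of 0] by simp
  then have "AE \<omega> in P. \<omega> \<in> {\<omega> \<in> space P. point_count (\<eta> \<omega>) (- W) = of_nat 0}"
    by (rule AE_prob_1)
  then show ?thesis
  proof (rule AE_mp, intro AE_I2 impI)
    fix \<omega> assume w: "\<omega> \<in> space P" and "\<omega> \<in> {\<omega> \<in> space P. point_count (\<eta> \<omega>) (- W) = of_nat 0}"
    then have "\<eta> \<omega> \<inter> - W = {}" by (simp add: point_count_def emeasure_count_space_eq_0)
    then have sub: "\<eta> \<omega> \<subseteq> W" by auto
    have "finite (\<eta> \<omega> \<inter> W)"
      by (rule random_config_finite[OF random_config_poisson[OF pp] w compact_imp_bounded[OF W]])
    then show "\<eta> \<omega> \<subseteq> W \<and> finite (\<eta> \<omega>)" using sub by (simp add: Int_absorb2)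
  qed
qed

lemma restricted_lebesgue_finite:
  fixes W :: "'a::euclidean_space set"
  assumes "compact W" shows "emeasure (restricted_lebesgue s W) W < \<infinity>"
  using emeasure_compact_finite[OF assms] borel_compact[OF assms]
  by (simp add: emeasure_restricted_lebesgue ennreal_mult_less_top)

text \<open>\<open>Max\<close> picks an occurring degree only from a finite nonempty set. A degree
  of positive probability is realised in a finite configuration, where
  \<open>separated_directions\<close> applies; the uniform bound on separated sets gives finiteness,
  and the maximum itself supplies \<open>U\<close>.\<close>

lemma k_max_le_separated:
  fixes W :: "'a::euclidean_space set" and \<eta> :: "real \<Rightarrow> 'w \<Rightarrow> 'a set"
  assumes pp: "\<And>s. s \<ge> 1 \<Longrightarrow> poisson_process (P s) (restricted_lebesgue s W) (\<eta> s)"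
    and W: "compact W" "measure lborel W > 0" and k: "k \<ge> 1"
  shows "\<exists>U. finite U \<and> (\<forall>u\<in>U. norm (u::'a) = 1) \<and> (\<forall>u\<in>U. \<forall>v\<in>U. u \<noteq> v \<longrightarrow> dist u v > 1) \<and>
    k_max P \<eta> k \<le> k * card U"
proof -
  define E where "E s j = {\<omega> \<in> space (P s). \<exists>y\<in>\<eta> s \<omega>. knn_degree k (\<eta> s \<omega>) y = j}" for s j
  define J where "J = {j. \<exists>s\<ge>1. measure (P s) (E s j) > 0}"
  have E_sets: "E s j \<in> sets (P s)" if "s \<ge> 1" for s j
    unfolding E_def by (rule sets_degree_occurs[OF random_config_poisson[OF pp[OF that]]])
  have sep: "\<exists>U. finite U \<and> (\<forall>u\<in>U. norm (u::'a) = 1) \<and> (\<forall>u\<in>U. \<forall>v\<in>U. u \<noteq> v \<longrightarrow> dist u v > 1) \<and> j \<le> k * card U"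
    if jJ: "j \<in> J" for j
  proof -
    obtain s where s: "s \<ge> 1" "measure (P s) (E s j) > 0" using jJ unfolding J_def by blast
    interpret prob_space "P s" using pp[OF s(1)] by (simp add: poisson_process_def)
    have "\<exists>\<omega>\<in>E s j. finite (\<eta> s \<omega>)"
    proof (rule ccontr)
      assume *: "\<not> ?thesis"
      have "AE \<omega> in P s. \<omega> \<notin> E s j"
        using poisson_AE_finite[OF pp[OF s(1)] W(1)]
        by (rule AE_mp, intro AE_I2) (use * in blast)
      then have "prob (E s j) = 0"
        using E_sets[OF s(1)] by (simp add: prob_eq_0)
      then show False using s(2) by simp
    qed
    then obtain \<omega> y where fX: "finite (\<eta> s \<omega>)" and y: "knn_degree k (\<eta> s \<omega>) y = j"
      unfolding E_def by blast
    let ?A = "{z. knn_adjacent k (\<eta> s \<omega>) y z}"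
    obtain U where U: "finite U" "U \<subseteq> (\<lambda>z. sgn (z - y)) ` ?A"
      "\<forall>u\<in>U. \<forall>v\<in>U. u \<noteq> v \<longrightarrow> dist u v > 1" "card ?A \<le> k * card U"
      using separated_directions[OF fX k order_refl, of y] by (elim exE conjE)
    have "norm u = 1" if "u \<in> U" for u
    proof -
      obtain z where "knn_adjacent k (\<eta> s \<omega>) y z" "u = sgn (z - y)" using U(2) \<open>u \<in> U\<close> by auto
      then show ?thesis by (auto simp: knn_adjacent_def norm_sgn)
    qed
    then show ?thesis using U y unfolding knn_degree_def by (intro exI[of _ U]) simp
  qed
  obtain K where K: "\<forall>U :: 'a set. finite U \<longrightarrow> (\<forall>u\<in>U. norm u = 1) \<longrightarrow>
      (\<forall>u\<in>U. \<forall>v\<in>U. u \<noteq> v \<longrightarrow> dist u v > 1) \<longrightarrow> card U \<le> K"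
    using separated_sphere_card_bound[where 'a = 'a] by (elim exE)
  have "J \<subseteq> {..k * K}"
  proof
    fix j assume "j \<in> J"
    from sep[OF this] obtain U :: "'a set" where "finite U" "\<forall>u\<in>U. norm u = 1"
      "\<forall>u\<in>U. \<forall>v\<in>U. u \<noteq> v \<longrightarrow> dist u v > 1" and jU: "j \<le> k * card U"
      by (elim exE conjE)
    then have "card U \<le> K" using K by simp
    then show "j \<in> {..k * K}" using jU mult_le_mono2[of "card U" K k] by (meson atMost_iff order_trans)
  qed
  then have fJ: "finite J" by (rule finite_subset) simp
  \<comment> \<open>If no degree occurred, the process at s = 1 would almost surely have no point in
    \<open>W\<close>; but it is void there with probability exp of minus the volume of
    \<open>W\<close>, which is less than 1.\<close>
  have "J \<noteq> {}"
  proof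
    assume J: "J = {}"
    interpret prob_space "P 1" using pp[of 1] by (simp add: poisson_process_def)
    let ?l = "measure (restricted_lebesgue 1 W) W"
    have "prob (E 1 j) = 0" for j
    proof -
      have "\<not> 0 < prob (E 1 j)" using J unfolding J_def by auto
      then show ?thesis by (simp add: zero_less_measure_iff)
    qed
    then have "AE \<omega> in P 1. \<omega> \<notin> E 1 j" for j
      using iffD1[OF prob_eq_0[OF E_sets[of 1 j]]] by simp
    then have "AE \<omega> in P 1. \<forall>j. \<omega> \<notin> E 1 j" by (simp add: AE_all_countable)
    then have "AE \<omega> in P 1. point_count (\<eta> 1 \<omega>) W = of_nat 0"
      by (rule AE_mp, intro AE_I2) (auto simp: E_def point_count_def emeasure_count_space_eq_0)
    moreover have "{\<omega> \<in> space (P 1). point_count (\<eta> 1 \<omega>) W = of_nat 0} \<in> sets (P 1)"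
      using random_config_count[OF random_config_poisson[OF pp[of 1]], of W] borel_compact[OF W(1)] by measurable
    ultimately have "prob {\<omega> \<in> space (P 1). point_count (\<eta> 1 \<omega>) W = of_nat 0} = 1"
      by (subst prob_Collect_eq_1) auto
    moreover have "prob {\<omega> \<in> space (P 1). point_count (\<eta> 1 \<omega>) W = of_nat 0} = exp (- ?l) * ?l ^ 0 / fact 0"
      using poisson_count_prob[OF pp[of 1] borel_compact[OF W(1)] restricted_lebesgue_finite[OF W(1)], of 0]
      by simp
    moreover have "?l = measure lborel W"
      by (simp add: measure_def emeasure_restricted_lebesgue borel_compact[OF W(1)])
    ultimately show False using W(2) by simp
  qed
  then have "Max J \<in> J" using fJ by (rule Max_in[rotated])
  then show ?thesis using sep[of "Max J"] unfolding k_max_def J_def E_def by blast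
qed

section \<open>Variance of a linear combination of degree counts\<close>

locale degree_statistic =
  fixes P :: "'w measure" and s :: real and W :: "'a::euclidean_space set" and \<eta> :: "'w \<Rightarrow> 'a set"
    and k :: nat and J :: "'i set" and j :: "'i \<Rightarrow> nat" and \<alpha> :: "'i \<Rightarrow> real"
  assumes pp: "poisson_process P (restricted_lebesgue s W) \<eta>" and W: "compact W" and J: "finite J"
begin

sublocale prob_space P using pp by (simp add: poisson_process_def)

text \<open>A functional of deterministic configurations, so that it can be evaluated on
  restrictions and rescaled copies of the process.\<close>

definition stat :: "'a set \<Rightarrow> real" where
  "stat X = (\<Sum>i\<in>J. \<alpha> i * real (num_degree k (j i) X))"

lemma stat_bound: "finite X \<Longrightarrow> \<bar>stat X\<bar> \<le> (\<Sum>i\<in>J. \<bar>\<alpha> i\<bar>) * real (card X)"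
proof -
  assume X: "finite X"
  have "\<bar>stat X\<bar> \<le> (\<Sum>i\<in>J. \<bar>\<alpha> i * real (num_degree k (j i) X)\<bar>)"
    unfolding stat_def by (rule sum_abs)
  also have "\<dots> \<le> (\<Sum>i\<in>J. \<bar>\<alpha> i\<bar> * real (card X))"
    using X by (intro sum_mono) (auto simp: abs_mult num_degree_def intro!: mult_left_mono card_mono)
  finally show ?thesis by (simp add: sum_distrib_right)
qed

lemma stat_measurable:
  "random_config M \<zeta> \<Longrightarrow> (\<lambda>\<omega>. stat (\<zeta> \<omega>)) \<in> borel_measurable M"
  unfolding stat_def
  by (intro borel_measurable_sum borel_measurable_times borel_measurable_const
      measurable_compose[OF measurable_num_degree]) auto

lemma stat_rescale: "h > 0 \<Longrightarrow> stat (rescale x h ` X) = stat X"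
  unfolding stat_def by (simp add: num_degree_similarity[of "1 / h" "rescale x h"] dist_rescale)

lemma W_borel: "W \<in> sets borel" using W by (rule borel_compact)

lemma integrable_card_square: "integrable P (\<lambda>\<omega>. (real (card (\<eta> \<omega> \<inter> W)))\<^sup>2)"
proof (rule integrable_poisson_count_square)
  have "(\<lambda>\<omega>. card {x \<in> \<eta> \<omega>. x \<in> W}) \<in> measurable P (count_space UNIV)"
    by (intro random_config_card[OF random_config_poisson[OF pp]]
        measurable_compose[OF measurable_snd, of "\<lambda>x. x \<in> W"]) (simp add: pred_def W_borel)
  then show "(\<lambda>\<omega>. card (\<eta> \<omega> \<inter> W)) \<in> measurable P (count_space UNIV)"
    by (simp add: Int_def)
  fix m
  have "finite (\<eta> \<omega> \<inter> W)" if "\<omega> \<in> space P" for \<omega>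
    by (rule random_config_finite[OF random_config_poisson[OF pp] that compact_imp_bounded[OF W]])
  then have "{\<omega> \<in> space P. card (\<eta> \<omega> \<inter> W) = m} = {\<omega> \<in> space P. point_count (\<eta> \<omega>) W = of_nat m}"
    by (auto simp: point_count_finite)
  then show "prob {\<omega> \<in> space P. card (\<eta> \<omega> \<inter> W) = m} =
      exp (- measure (restricted_lebesgue s W) W) * measure (restricted_lebesgue s W) W ^ m / fact m"
    using poisson_count_prob[OF pp W_borel restricted_lebesgue_finite[OF W]] by simp
qed (auto intro: prob_space_axioms)

lemma integrable_stat:
  assumes A: "A \<in> sets borel"
  shows "integrable P (\<lambda>\<omega>. (stat (\<eta> \<omega> \<inter> A))\<^sup>2)" "integrable P (\<lambda>\<omega>. stat (\<eta> \<omega> \<inter> A))"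
proof -
  have "(\<lambda>\<omega>. stat (\<eta> \<omega> \<inter> A)) \<in> borel_measurable (count_sigma P \<eta> A)"
    by (rule stat_measurable[OF random_config_restrict[OF random_config_poisson[OF pp] A]])
  then have meas: "(\<lambda>\<omega>. stat (\<eta> \<omega> \<inter> A)) \<in> borel_measurable P"
    by (rule measurable_from_subalg[rotated])
       (simp add: subalgebra_def count_sigma_sets[OF random_config_poisson[OF pp]])
  let ?a = "\<Sum>i\<in>J. \<bar>\<alpha> i\<bar>"
  show sq: "integrable P (\<lambda>\<omega>. (stat (\<eta> \<omega> \<inter> A))\<^sup>2)"
  proof (rule Bochner_Integration.integrable_bound)
    show "integrable P (\<lambda>\<omega>. ?a\<^sup>2 * (real (card (\<eta> \<omega> \<inter> W)))\<^sup>2)"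
      by (intro integrable_mult_right integrable_card_square)
    show "(\<lambda>\<omega>. (stat (\<eta> \<omega> \<inter> A))\<^sup>2) \<in> borel_measurable P" using meas by measurable
    show "AE \<omega> in P. norm ((stat (\<eta> \<omega> \<inter> A))\<^sup>2) \<le> norm (?a\<^sup>2 * (real (card (\<eta> \<omega> \<inter> W)))\<^sup>2)"
      using poisson_AE_finite[OF pp W]
    proof (rule AE_mp, intro AE_I2 impI)
      fix \<omega> assume fin: "\<eta> \<omega> \<subseteq> W \<and> finite (\<eta> \<omega>)"
      have "\<bar>stat (\<eta> \<omega> \<inter> A)\<bar> \<le> ?a * real (card (\<eta> \<omega> \<inter> A))" using fin by (intro stat_bound) simp
      also have "\<dots> \<le> ?a * real (card (\<eta> \<omega> \<inter> W))"
        using fin by (intro mult_left_mono of_nat_mono card_mono sum_nonneg) auto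
      finally have "\<bar>stat (\<eta> \<omega> \<inter> A)\<bar>\<^sup>2 \<le> (?a * real (card (\<eta> \<omega> \<inter> W)))\<^sup>2"
        by (intro power_mono) auto
      then show "norm ((stat (\<eta> \<omega> \<inter> A))\<^sup>2) \<le> norm (?a\<^sup>2 * (real (card (\<eta> \<omega> \<inter> W)))\<^sup>2)"
        by (simp add: power_mult_distrib abs_mult)
    qed
  qed
  show "integrable P (\<lambda>\<omega>. stat (\<eta> \<omega> \<inter> A))"
    using square_integrable_imp_integrable[OF meas sq] .
qed

end

context degree_statistic
begin

lemma stat_eq_sum:
  assumes "finite X"
  shows "stat X = (\<Sum>x\<in>X. \<Sum>i\<in>J. if j i = knn_degree k X x then \<alpha> i else 0)"
  unfolding stat_def by (rule sum_num_degree[OF assms J])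

text \<open>The inner term is taken in rescaled coordinates, where the pattern fixes its value. The
  outer term depends only on points outside the inner ball and hence is independent of events
  inside.\<close>

lemma stat_local_decomposition:
  assumes X: "finite X" and h: "h > 0"
    and net: "\<And>x. norm x = 1 \<Longrightarrow> \<exists>i<m'. dist x (w i) < 1/2" and w1: "\<And>i. i < m' \<Longrightarrow> norm (w i) = 1"
    and \<delta>': "\<delta>' \<le> 1"
    and shield: "matches m' (\<lambda>i. 10 *\<^sub>R w i) \<delta>' (\<lambda>_. Suc k) (ball 0 12 - ball 0 2) (rescale v h ` X)"
    and inner: "k < card (rescale v h ` X \<inter> ball 0 2)"
  shows "stat X = stat (rescale v h ` X \<inter> ball 0 2) + stat (X \<inter> - (rescale v h -` ball 0 2))"
proof -
  let ?r = "rescale v h"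
  have "stat X = stat (?r ` X)" using stat_rescale[OF h] by simp
  also have "\<dots> = stat (?r ` X \<inter> ball 0 2) + stat (?r ` X - ball 0 2)"
    unfolding stat_def
    using shielded_num_degree[OF finite_imageI[OF X] net w1 \<delta>' shield inner]
    by (simp add: distrib_left sum.distrib)
  also have "?r ` X - ball 0 2 = ?r ` (X \<inter> - (?r -` ball 0 2))" by auto
  also have "stat \<dots> = stat (X \<inter> - (?r -` ball 0 2))" by (rule stat_rescale[OF h])
  finally show ?thesis .
qed

text \<open>The weights in \<open>g\<close> are crossed, \<open>pb\<close> on the pattern and
  \<open>pa\<close> on the empty ball. This centres \<open>g v\<close> and at the same time cancels
  the random outer contribution in its covariance with the statistic, so that only the deterministic
  \<open>f\<close> is left.\<close>

lemma variance_stat_ge: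
  assumes V: "finite V" and h: "h > 0" "s * h ^ DIM('a) = 1"
    and VW: "\<And>v. v \<in> V \<Longrightarrow> ball v (h * 12) \<subseteq> W"
    and apart: "\<And>v v'. v \<in> V \<Longrightarrow> v' \<in> V \<Longrightarrow> v \<noteq> v' \<Longrightarrow> 24 * h \<le> dist v v'"
    and cells: "cells_in m c \<delta> (ball (0::'a) 2)"
    and pattern: "\<And>X. finite X \<Longrightarrow> X \<subseteq> ball 0 2 \<Longrightarrow> matches m c \<delta> n (ball 0 2) X \<Longrightarrow> k < card X \<and> stat X = f"
    and net: "\<And>x. norm x = 1 \<Longrightarrow> \<exists>i<m'. dist x (w i) < 1/2" and w1: "\<And>i. i < m' \<Longrightarrow> norm (w i) = 1"
    and \<delta>': "\<delta>' \<le> 1" and shield: "cells_in m' (\<lambda>i. 10 *\<^sub>R w i) \<delta>' (ball (0::'a) 12 - ball 0 2)"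
  defines "pa \<equiv> pattern_prob m c \<delta> n (ball 0 2)" and "pb \<equiv> pattern_prob 0 c \<delta> n (ball 0 2)"
    and "pS \<equiv> pattern_prob m' (\<lambda>i. 10 *\<^sub>R w i) \<delta>' (\<lambda>_. Suc k) (ball 0 12 - ball 0 2)"
  shows "real (card V) * (f * pa * pb * pS)\<^sup>2 \<le> variance (\<lambda>\<omega>. stat (\<eta> \<omega>))"
proof -
  let ?r = "\<lambda>v :: 'a. rescale v h"
  define inn where "inn v = ?r v -` ball 0 2" for v
  define shell where "shell v = ?r v -` (ball 0 12 - ball 0 2)" for v
  define Ea where "Ea v = {\<omega> \<in> space P. matches m c \<delta> n (ball 0 2) (?r v ` \<eta> \<omega>)}" for v
  define Eb where "Eb v = {\<omega> \<in> space P. matches 0 c \<delta> n (ball 0 2) (?r v ` \<eta> \<omega>)}" for v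
  define ES where "ES v = {\<omega> \<in> space P.
      matches m' (\<lambda>i. 10 *\<^sub>R w i) \<delta>' (\<lambda>_. Suc k) (ball 0 12 - ball 0 2) (?r v ` \<eta> \<omega>)}" for v
  define Y where "Y v \<omega> = stat (\<eta> \<omega> \<inter> - inn v)" for v \<omega>
  define g where "g v \<omega> = pb * indicator (ES v \<inter> Ea v) \<omega> - pa * indicator (ES v \<inter> Eb v) \<omega>" for v \<omega>
  note rc = random_config_poisson[OF pp]
  note sub = count_sigma_sets[OF rc]
  have cells0: "cells_in 0 c \<delta> (ball (0::'a) 2)" using cells by (simp add: cells_in_def)
  have big: "?r v -` ball 0 12 = ball v (h * 12)" for v by (rule rescale_vimage_ball[OF h(1)])
  have inn_sub: "inn v \<subseteq> ?r v -` ball 0 12" and shell_sub: "shell v \<subseteq> ?r v -` ball 0 12" for v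
    by (auto simp: inn_def shell_def)
  have inn_W: "inn v \<subseteq> W" and shell_W: "shell v \<subseteq> W" if "v \<in> V" for v
    using inn_sub[of v] shell_sub[of v] VW[OF that] unfolding big by blast+
  have inn_sets: "inn v \<in> sets borel" for v
    using measurable_sets[OF rescale_measurable, of "ball 0 2" v h] by (simp add: inn_def)
  have Ea: "Ea v \<in> sets (count_sigma P \<eta> (inn v))" "prob (Ea v) = pa" if "v \<in> V" for v
    using prob_matches[OF pp W_borel cells bounded_ball _ h inn_W[OF that, unfolded inn_def]]
    unfolding Ea_def inn_def pa_def by auto
  have Eb: "Eb v \<in> sets (count_sigma P \<eta> (inn v))" "prob (Eb v) = pb" if "v \<in> V" for v
    using prob_matches[OF pp W_borel cells0 bounded_ball _ h inn_W[OF that, unfolded inn_def]]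
    unfolding Eb_def inn_def pb_def by auto
  have ES: "ES v \<in> sets (count_sigma P \<eta> (shell v))" "prob (ES v) = pS" if "v \<in> V" for v
    using prob_matches[OF pp W_borel shield bounded_subset[OF bounded_ball Diff_subset] _ h
        shell_W[OF that, unfolded shell_def]]
    unfolding ES_def shell_def pS_def by auto
  have ab1: "0 \<le> pa" "pa \<le> 1" "0 \<le> pb" "pb \<le> 1" if "v \<in> V" for v
    using Ea(2)[OF that] Eb(2)[OF that] by (metis measure_nonneg prob_le_1)+
  have events: "Ea v \<in> events" "Eb v \<in> events" "ES v \<in> events" if "v \<in> V" for v
    using Ea(1)[OF that] Eb(1)[OF that] ES(1)[OF that] sub by blast+
  have disj: "shell v \<inter> inn v = {}" "inn v \<inter> shell v = {}" "inn v \<inter> - inn v = {}" for v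
    by (auto simp: inn_def shell_def)
  have pSa: "prob (ES v \<inter> Ea v) = pS * pa" and pSb: "prob (ES v \<inter> Eb v) = pS * pb" if "v \<in> V" for v
    using indep_setD[OF indep_count_sigma[OF pp disj(1)] ES(1)[OF that] Ea(1)[OF that]]
      indep_setD[OF indep_count_sigma[OF pp disj(1)] ES(1)[OF that] Eb(1)[OF that]]
      Ea(2)[OF that] Eb(2)[OF that] ES(2)[OF that] by simp_all
  have SE_big: "ES v \<inter> Ea v \<in> sets (count_sigma P \<eta> (ball v (h * 12)))"
    "ES v \<inter> Eb v \<in> sets (count_sigma P \<eta> (ball v (h * 12)))" if "v \<in> V" for v
    using Ea(1)[OF that] Eb(1)[OF that] ES(1)[OF that]
      count_sigma_mono[OF inn_sub[of v]] count_sigma_mono[OF shell_sub[of v]] unfolding big by blast+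
  have g_big: "g v \<in> borel_measurable (count_sigma P \<eta> (ball v (h * 12)))" if "v \<in> V" for v
    unfolding g_def using SE_big[OF that] by (intro borel_measurable_diff borel_measurable_times) auto
  have g_meas: "g v \<in> borel_measurable P" if "v \<in> V" for v
    unfolding g_def using events[OF that] by (intro borel_measurable_diff borel_measurable_times) auto
  have g_bound: "\<bar>g v \<omega>\<bar> \<le> 1" if "v \<in> V" for v \<omega>
    using ab1[OF that] unfolding g_def by (auto simp: indicator_def)
  have int_g: "integrable P (g v)" if "v \<in> V" for v
    using g_bound[OF that] g_meas[OF that] by (intro integrable_const_bound[of _ 1]) auto
  have int_ind: "integrable P (indicator A :: _ \<Rightarrow> real)" if "A \<in> events" for A
    using that by (intro integrable_real_indicator) (simp_all add: emeasure_eq_measure)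
  have mean: "expectation (g v) = 0" if "v \<in> V" for v
  proof -
    have "expectation (g v) = pb * prob (ES v \<inter> Ea v) - pa * prob (ES v \<inter> Eb v)"
      unfolding g_def using events[OF that] int_ind by simp
    then show ?thesis using pSa[OF that] pSb[OF that] by simp
  qed
  have uncorr: "expectation (\<lambda>\<omega>. g v \<omega> * g v' \<omega>) = 0" if v: "v \<in> V" and v': "v' \<in> V" and ne: "v \<noteq> v'" for v v'
  proof -
    \<comment> \<open>These balls include the shells, so \<open>g v\<close> and \<open>g v'\<close>
      are governed by disjoint regions.\<close>
    have d: "ball v (h * 12) \<inter> ball v' (h * 12) = {}"
      using apart[OF v v' ne] by (intro ball_disjointI) simp
    have ind: "expectation (\<lambda>\<omega>. g v' \<omega> * indicator A \<omega>) = 0"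
      if "A \<in> sets (count_sigma P \<eta> (ball v (h * 12)))" for A
      using expectation_times_indicator[OF pp d that g_big[OF v'] int_g[OF v']] mean[OF v'] by simp
    have int: "integrable P (\<lambda>\<omega>. g v' \<omega> * indicator A \<omega>)" if "A \<in> events" for A
      using that int_g[OF v'] by (rule integrable_real_mult_indicator)
    have "(\<lambda>\<omega>. g v \<omega> * g v' \<omega>) = (\<lambda>\<omega>. pb * (g v' \<omega> * indicator (ES v \<inter> Ea v) \<omega>)
        - pa * (g v' \<omega> * indicator (ES v \<inter> Eb v) \<omega>))"
      unfolding g_def[of v] by (auto simp: algebra_simps)
    then show ?thesis
      using ind[OF SE_big(1)[OF v]] ind[OF SE_big(2)[OF v]] int events[OF v] by simp
  qed
  have corr: "expectation (\<lambda>\<omega>. stat (\<eta> \<omega>) * g v \<omega>) = f * pa * pb * pS" if v: "v \<in> V" for v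
  proof -
    let ?Z = "\<lambda>\<omega>. Y v \<omega> * indicator (ES v) \<omega>"
    have Y_meas: "Y v \<in> borel_measurable (count_sigma P \<eta> (- inn v))"
      unfolding Y_def using inn_sets by (intro stat_measurable random_config_restrict[OF rc]) auto
    have "ES v \<in> sets (count_sigma P \<eta> (- inn v))"
      using ES(1)[OF v] count_sigma_mono[of "shell v" "- inn v"] disj by blast
    then have Z_meas: "?Z \<in> borel_measurable (count_sigma P \<eta> (- inn v))"
      using Y_meas by (intro borel_measurable_times) auto
    have Y_int: "integrable P (Y v)"
      unfolding Y_def using inn_sets by (intro integrable_stat) auto
    then have Z_int: "integrable P ?Z" using events(3)[OF v] by (intro integrable_real_mult_indicator)
    have ZE: "expectation (\<lambda>\<omega>. ?Z \<omega> * indicator A \<omega>) = expectation ?Z * prob A"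
      "integrable P (\<lambda>\<omega>. ?Z \<omega> * indicator A \<omega>)"
      if "A \<in> sets (count_sigma P \<eta> (inn v))" for A
      using expectation_times_indicator[OF pp disj(3) that Z_meas Z_int]
        integrable_real_mult_indicator[OF subsetD[OF sub that] Z_int] by auto
    \<comment> \<open>On \<open>ES v \<inter> Ea v\<close> the statistic is \<open>f + Y v\<close>,
      and on \<open>Eb v\<close> it is \<open>Y v\<close>; elsewhere \<open>g v\<close> vanishes or
      only one indicator survives.\<close>
    have "AE \<omega> in P. stat (\<eta> \<omega>) * g v \<omega> = pb * (?Z \<omega> * indicator (Ea v) \<omega>) - pa * (?Z \<omega> * indicator (Eb v) \<omega>)
        + f * pb * indicator (ES v \<inter> Ea v) \<omega>"
      using poisson_AE_finite[OF pp W]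
    proof (rule AE_mp, intro AE_I2 impI)
      fix \<omega> assume "\<omega> \<in> space P" and fin: "\<eta> \<omega> \<subseteq> W \<and> finite (\<eta> \<omega>)"
      have a: "stat (\<eta> \<omega>) = f + Y v \<omega>" if "\<omega> \<in> ES v" "\<omega> \<in> Ea v"
      proof -
        let ?I = "?r v ` \<eta> \<omega> \<inter> ball 0 2"
        have "ball (c i) \<delta> \<subseteq> ball 0 2" if "i < m" for i using cells that by (simp add: cells_in_def)
        then have "?I \<inter> ball (c i) \<delta> = ?r v ` \<eta> \<omega> \<inter> ball (c i) \<delta>" if "i < m" for i using that by blast
        then have "matches m c \<delta> n (ball 0 2) ?I"
          using \<open>\<omega> \<in> Ea v\<close> unfolding Ea_def matches_def by auto
        then have I: "k < card ?I" "stat ?I = f" using pattern[of ?I] fin by auto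
        show ?thesis
          using stat_local_decomposition[OF _ h(1) net w1 \<delta>' _ I(1)] fin that(1) I(2)
          unfolding ES_def Y_def inn_def by simp
      qed
      have b: "stat (\<eta> \<omega>) = Y v \<omega>" if "\<omega> \<in> Eb v"
      proof -
        have "\<eta> \<omega> \<inter> inn v = {}" using that unfolding Eb_def matches_def inn_def by auto
        then have "\<eta> \<omega> \<inter> - inn v = \<eta> \<omega>" by blast
        then show ?thesis by (simp add: Y_def)
      qed
      show "stat (\<eta> \<omega>) * g v \<omega> = pb * (?Z \<omega> * indicator (Ea v) \<omega>) - pa * (?Z \<omega> * indicator (Eb v) \<omega>)
        + f * pb * indicator (ES v \<inter> Ea v) \<omega>"
        unfolding g_def using a b
        by (cases "\<omega> \<in> ES v"; cases "\<omega> \<in> Ea v"; cases "\<omega> \<in> Eb v") (auto simp: algebra_simps)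
    qed
    moreover have "(\<lambda>\<omega>. stat (\<eta> \<omega>) * g v \<omega>) \<in> borel_measurable P"
      using stat_measurable[OF rc] g_meas[OF v] by measurable
    moreover have "(\<lambda>\<omega>. pb * (?Z \<omega> * indicator (Ea v) \<omega>) - pa * (?Z \<omega> * indicator (Eb v) \<omega>)
        + f * pb * indicator (ES v \<inter> Ea v) \<omega>) \<in> borel_measurable P"
      using borel_measurable_integrable[OF Y_int] events[OF v]
      by (intro borel_measurable_add borel_measurable_diff borel_measurable_times) auto
    ultimately have "expectation (\<lambda>\<omega>. stat (\<eta> \<omega>) * g v \<omega>) =
        expectation (\<lambda>\<omega>. pb * (?Z \<omega> * indicator (Ea v) \<omega>) - pa * (?Z \<omega> * indicator (Eb v) \<omega>)
          + f * pb * indicator (ES v \<inter> Ea v) \<omega>)"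
      by (intro integral_cong_AE)
    \<comment> \<open>The shell indicator is part of \<open>?Z\<close>, which depends on outer
      points only; the inner events factor out and the two terms with \<open>expectation ?Z\<close>
      cancel.\<close>
    also have "\<dots> = pb * (expectation ?Z * pa) - pa * (expectation ?Z * pb) + f * pb * (pS * pa)"
      using ZE[OF Ea(1)[OF v]] ZE[OF Eb(1)[OF v]] Ea(2)[OF v] Eb(2)[OF v] pSa[OF v] events[OF v] int_ind
      by simp
    finally show ?thesis by (simp add: algebra_simps)
  qed
  show ?thesis
    using integrable_stat[of UNIV] V g_meas g_bound mean corr uncorr
    by (intro variance_ge_of_uncorrelated) auto
qed

end

section \<open>Choice of degree, pattern and packing; the bound linear in s\<close>

theorem theorem3p5:
  fixes W :: "(real ^ 'd) set"
    and P :: "real \<Rightarrow> 'w measure"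
    and \<eta> :: "real \<Rightarrow> 'w \<Rightarrow> (real ^ 'd) set"
    and k n :: nat
    and j :: "nat \<Rightarrow> nat"
    and \<alpha> :: "nat \<Rightarrow> real"
  assumes "CARD('d) \<ge> 2"
    and "W \<noteq> {}" and "compact W" and "convex W" and "measure lborel W > 0"
    and "\<And>s. s \<ge> 1 \<Longrightarrow> poisson_process (P s) (restricted_lebesgue s W) (\<eta> s)"
    and "k \<ge> 1"
    and "n + k \<le> k_max P \<eta> k + 1"
    and "inj_on j {1..n}" and "\<And>i. i \<in> {1..n} \<Longrightarrow> j i \<in> {k..k_max P \<eta> k}"
    and "\<exists>i\<in>{1..n}. \<alpha> i \<noteq> 0"
  shows "\<exists>c>0. eventually (\<lambda>s.
           prob_space.variance (P s)
             (\<lambda>\<omega>. \<Sum>i=1..n. \<alpha> i * real (num_degree k (j i) (\<eta> s \<omega>))) \<ge> c * s) at_top"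
proof -
  \<comment> \<open>\<beta> collects the coefficients by degree; since the \<open>j i\<close> are
    distinct, it equals \<open>\<alpha> i0\<close> at \<open>j i0\<close>.\<close>
  define \<beta> where "\<beta> D = (\<Sum>i\<in>{1..n}. if j i = D then \<alpha> i else 0)" for D
  obtain i0 where i0: "i0 \<in> {1..n}" "\<alpha> i0 \<noteq> 0" using assms(11) by blast
  have "\<beta> (j i0) = (\<Sum>i\<in>{1..n}. if i = i0 then \<alpha> i else 0)"
    unfolding \<beta>_def by (intro sum.cong refl) (use i0(1) inj_on_eq_iff[OF assms(9)] in simp)
  then have "\<beta> (j i0) \<noteq> 0" using i0 by simp
  define D where "D = (LEAST D. \<beta> D \<noteq> 0)"
  have D: "\<beta> D \<noteq> 0" unfolding D_def by (rule LeastI[of _ "j i0"]) fact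
  have D_min: "\<beta> i = 0" if "i < D" for i using not_less_Least that unfolding D_def by blast
  have "\<exists>i\<in>{1..n}. j i = D"
  proof (rule ccontr)
    assume "\<not> ?thesis"
    then have "\<beta> D = 0" unfolding \<beta>_def by (intro sum.neutral) auto
    then show False using D by simp
  qed
  then obtain i where "i \<in> {1..n}" "j i = D" by blast
  then have D_range: "k \<le> D" "D \<le> k_max P \<eta> k" using assms(10)[of i] by auto
  have "\<exists>U. finite U \<and> (\<forall>u\<in>U. norm (u :: real ^ 'd) = 1) \<and>
      (\<forall>u\<in>U. \<forall>v\<in>U. u \<noteq> v \<longrightarrow> dist u v > 1) \<and> k_max P \<eta> k \<le> k * card U"
    by (rule k_max_le_separated) (use assms(3,5,6,7) in auto)
  then obtain U :: "(real ^ 'd) set" where U: "finite U" "\<forall>u\<in>U. norm u = 1"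
    "\<forall>u\<in>U. \<forall>v\<in>U. u \<noteq> v \<longrightarrow> dist u v > 1" and kU: "k_max P \<eta> k \<le> k * card U"
    by (elim exE conjE)
  have DU: "D \<le> k * card U" using D_range kU by linarith
  have "\<exists>m (c :: nat \<Rightarrow> real ^ 'd) \<delta> N f. cells_in m c \<delta> (ball 0 2) \<and> f \<noteq> 0 \<and>
    (\<forall>X. finite X \<longrightarrow> X \<subseteq> ball 0 2 \<longrightarrow> matches m c \<delta> N (ball 0 2) X \<longrightarrow>
      k < card X \<and> (\<Sum>x\<in>X. \<beta> (knn_degree k X x)) = f)"
    by (rule inner_pattern_exists[where \<beta> = \<beta> and U = U and D = D])
       (use assms(7) U D_range(1) DU D D_min in auto)
  then obtain m and c :: "nat \<Rightarrow> real ^ 'd" and \<delta> N f where cells: "cells_in m c \<delta> (ball 0 2)" and f: "f \<noteq> 0"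
    and pattern: "\<forall>X. finite X \<longrightarrow> X \<subseteq> ball 0 2 \<longrightarrow> matches m c \<delta> N (ball 0 2) X \<longrightarrow>
      k < card X \<and> (\<Sum>x\<in>X. \<beta> (knn_degree k X x)) = f"
    by (elim exE conjE)
  obtain m' and w :: "nat \<Rightarrow> real ^ 'd" and \<delta>' where
    net: "\<forall>x. norm x = 1 \<longrightarrow> (\<exists>i<m'. dist x (w i) < 1/2)" "\<forall>i<m'. norm (w i) = 1" "\<delta>' \<le> 1" and
    shield: "cells_in m' (\<lambda>i. 10 *\<^sub>R w i) \<delta>' (ball 0 12 - ball 0 2)"
    using shield_exists[where 'a = "real ^ 'd"] by (elim exE conjE)
  define pa where "pa = pattern_prob m c \<delta> N (ball 0 2)"
  define pb where "pb = pattern_prob 0 c \<delta> N (ball 0 2)"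
  define pS where "pS = pattern_prob m' (\<lambda>i. 10 *\<^sub>R w i) \<delta>' (\<lambda>_. Suc k) (ball 0 12 - ball 0 2)"
  define \<kappa> where "\<kappa> = f * pa * pb * pS"
  have "pa > 0" "pb > 0" "pS > 0"
    unfolding pa_def pb_def pS_def using cells shield by (auto intro!: pattern_prob_pos simp: cells_in_def)
  then have \<kappa>: "\<kappa>\<^sup>2 > 0" using f by (simp add: \<kappa>_def)
  \<comment> \<open>A convex set with empty interior is negligible, so positive volume provides a
    ball in \<open>W\<close> to be packed.\<close>
  have "emeasure lborel W \<noteq> 0" using assms(5) by (auto simp: measure_def)
  then have "\<not> negligible W"
    using borel_compact[OF assms(3)] by (simp add: negligible_iff_null_sets null_sets_def)
  then have "interior W \<noteq> {}" using negligible_convex_interior[OF assms(4)] by simp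
  then obtain w0 \<rho> where \<rho>: "\<rho> > 0" "ball w0 \<rho> \<subseteq> W" by (auto simp: mem_interior)
  define a where "a = \<rho> / (48 * (real CARD('d) + 1))"
  have a: "a > 0" using \<rho>(1) by (simp add: a_def add_nonneg_pos)
  have "((\<lambda>s. s powr (- (1 / real CARD('d)))) \<longlongrightarrow> 0) at_top"
    by (rule tendsto_neg_powr) (simp_all add: filterlim_ident)
  then have "eventually (\<lambda>s. s powr (- (1 / real CARD('d))) < a) at_top"
    using a by (rule order_tendstoD(2))
  then have "eventually (\<lambda>s. a ^ CARD('d) * \<kappa>\<^sup>2 * s \<le> prob_space.variance (P s)
             (\<lambda>\<omega>. \<Sum>i=1..n. \<alpha> i * real (num_degree k (j i) (\<eta> s \<omega>)))) at_top"
    using eventually_ge_at_top[of 1]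
  proof eventually_elim
    case (elim s)
    define h where "h = s powr (- (1 / real CARD('d)))"
    have h: "h > 0" "h \<le> a" using elim by (auto simp: h_def)
    have "h ^ CARD('d) = s powr (- 1)"
      using elim by (simp add: h_def powr_powr flip: powr_realpow)
    then have sh: "s * h ^ CARD('d) = 1" using elim by (simp add: powr_minus)
    interpret degree_statistic "P s" s W "\<eta> s" k "{1..n}" j \<alpha>
      using assms(3,6) elim by unfold_locales auto
    obtain V where V: "finite V" "(a / h) ^ CARD('d) \<le> real (card V)"
      "\<forall>v\<in>V. ball v (h * 12) \<subseteq> ball w0 \<rho>" "\<forall>v\<in>V. \<forall>w\<in>V. v \<noteq> w \<longrightarrow> 24 * h \<le> dist v w"
      using lattice_packing[OF \<rho>(1) h(1) h(2)[unfolded a_def], of w0] unfolding a_def by (elim exE conjE)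
    \<comment> \<open>The linear growth in \<open>s\<close> arises here: at least
      \<open>a ^ CARD('d) * s\<close> balls fit into the fixed ball.\<close>
    have ah: "(a / h) ^ CARD('d) = a ^ CARD('d) * s"
      using sh h(1) by (simp add: power_divide field_simps)
    have "real (card V) * \<kappa>\<^sup>2 \<le> variance (\<lambda>\<omega>. stat (\<eta> s \<omega>))"
      unfolding \<kappa>_def pa_def pb_def pS_def
    proof (rule variance_stat_ge[OF V(1) h(1) _ _ _ cells _ _ _ net(3) shield])
      show "k < card X \<and> stat X = f" if "finite X" "X \<subseteq> ball 0 2" "matches m c \<delta> N (ball 0 2) X" for X
        unfolding stat_eq_sum[OF that(1)] using pattern[unfolded \<beta>_def] that by simp
      show "ball v (h * 12) \<subseteq> W" if "v \<in> V" for v using V(3) \<rho>(2) that by blast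
    qed (use sh V(4) net(1,2) in auto)
    moreover have "a ^ CARD('d) * s * \<kappa>\<^sup>2 \<le> real (card V) * \<kappa>\<^sup>2"
      using V(2) \<kappa> unfolding ah by (intro mult_right_mono) auto
    ultimately have "a ^ CARD('d) * \<kappa>\<^sup>2 * s \<le> variance (\<lambda>\<omega>. stat (\<eta> s \<omega>))"
      by (simp add: mult_ac)
    then show ?case unfolding stat_def .
  qed
  then show ?thesis using a \<kappa> by (intro exI[of _ "a ^ CARD('d) * \<kappa>\<^sup>2"]) auto
qed

end
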